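(* Consider the distributionally robust CVaR problem $$\text{(DRCVaR)}\qquad \min_{x\in\Delta_d}\ \max_{P\in\mathscr{P}}\ \Big\{\mathbb{E}_P[\psi(\xi_a-\xi_B^\top x)]+\tau_1\|x\|^2+\tau_2\,\phi_\beta(x)\Big\},$$ where $\phi_\beta(x)=\min_{\alpha\in\mathbb{R}}\{\alpha+(1-\beta)^{-1}\mathbb{E}_P[-x^\top\xi_B-\alpha]_+\}$ (depending on $P$), and the nonsmooth problem $$\text{(NSDP)}\qquad \min_{\nu\in\mathcal{V}}\ \max_{\xi\in\Xi}\ h_\xi(\nu),\qquad \nu=(x,\alpha,q,\Lambda),\quad \mathcal{V}=\Delta_d\times\mathbb{R}\times\mathbb{R}^{d+1}\times\mathbb{S}_+^{d+1}.$$ Then the optimal values of (DRCVaR) and (NSDP) are equal, in the sense that $x$ is an optimal solution of (DRCVaR) if and only if there exist $\alpha\in\mathbb{R}$, $q\in\mathbb{R}^{d+1}$ and $\Lambda\in\mathbb{S}_+^{d+1}$ such that $(x,\alpha,q,\Lambda)$ is an optimal solution of (NSDP).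
   Context: $\Delta_d=\{x\in\mathbb{R}^d : \sum_{i=1}^d x_i=1,\ x\ge 0\}$. $\mathbb{S}_+^{d+1}$ is the cone of symmetric positive semidefinite $(d+1)\times(d+1)$ matrices; $M\preceq N$ means $N-M$ is positive semidefinite; $\|\cdot\|$ is the Euclidean norm; $[t]_+=\max\{t,0\}$; $\langle M,N\rangle=\sum_{i,j}M_{i,j}N_{i,j}$. $\Xi\subseteq\mathbb{R}^{d+1}$ is a convex compact set with Borel $\sigma$-algebra, and $\mathcal{M}$ is the set of all Borel probability measures on $\Xi$. Elements are written $\xi=(\xi_B^\top,\xi_a)^\top$ with $\xi_B\in\mathbb{R}^d$, $\xi_a\in\mathbb{R}$. The vector $\hat\mu\in\mathbb{R}^{d+1}$ and the symmetric positive definite matrix $\hat\Sigma$ are the mean vector and covariance matrix of finitely many historical observations of the random vector $\xi$, all lying in $\Xi$. The function $\psi:\mathbb{R}\to\mathbb{R}$ is convex (for instance $\psi(a)=|a|$ or $\psi(a)=a^2$), $\tau_1,\tau_2\ge 0$, $\beta\in(0,1)$, $\kappa_1>0$, $\kappa_2>0$. The ambiguity set is $$\mathscr{P}=\Big\{P\in\mathcal{M} : (\mathbb{E}_P[\xi]-\hat\mu)^\top\hat\Sigma^{-1}(\mathbb{E}_P[\xi]-\hat\mu)\le\kappa_1,\ \ \mathbb{E}_P\big[(\xi-\hat\mu)(\xi-\hat\mu)^\top\big]\preceq\kappa_2\hat\Sigma\Big\}.$$ The function $h_\xi$ is $$h_\xi(\nu)=h_1(\nu)+\sqrt{\kappa_1}\,\big\|\hat\Sigma^{1/2}(q+2\Lambda\hat\mu)\big\|+h_{2,\xi}(\nu),$$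 $$h_1(\nu)=\langle\kappa_2\hat\Sigma,\Lambda\rangle+(\Lambda^\top\hat\mu+q)^\top\hat\mu+\tau_1\|x\|^2+\tau_2\alpha,$$ $$h_{2,\xi}(\nu)=\psi(\xi_a-\xi_B^\top x)-(\Lambda^\top\xi+q)^\top\xi+\frac{\tau_2}{1-\beta}\big[-x^\top\xi_B-\alpha\big]_+.$$ *)

theory Defs
  imports "HOL-Probability.Probability"
begin

text \<open>
  The random vector lives in \<open>real ^ ('d + 1)\<close>, whose index type has \<open>CARD('d) + 1\<close> elements:
  the coordinates \<open>Inl i\<close> form the part \<open>\<xi>\<^sub>B\<close> and the coordinate \<open>Inr 1\<close> is \<open>\<xi>\<^sub>a\<close>.
\<close>

definition part_B :: "real ^ ('d::finite + 1) \<Rightarrow> real ^ 'd" where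
  "part_B \<xi> = (\<chi> i. \<xi> $ Inl i)"

definition part_a :: "real ^ ('d::finite + 1) \<Rightarrow> real" where
  "part_a \<xi> = \<xi> $ Inr 1"

definition prob_simplex :: "(real ^ 'd) set" where
  "prob_simplex = {x. (\<Sum>i\<in>UNIV. x $ i) = 1 \<and> (\<forall>i. 0 \<le> x $ i)}"

definition psd_matrix :: "real ^ 'n ^ 'n \<Rightarrow> bool" where
  "psd_matrix M \<longleftrightarrow> transpose M = M \<and> (\<forall>v. 0 \<le> v \<bullet> (M *v v))"

definition pd_matrix :: "real ^ 'n ^ 'n \<Rightarrow> bool" where
  "pd_matrix M \<longleftrightarrow> transpose M = M \<and> (\<forall>v. v \<noteq> 0 \<longrightarrow> 0 < v \<bullet> (M *v v))"

definition loewner_le :: "real ^ 'n ^ 'n \<Rightarrow> real ^ 'n ^ 'n \<Rightarrow> bool" (infix \<open>\<preceq>\<close> 50) where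
  "M \<preceq> N \<longleftrightarrow> psd_matrix (N - M)"

text \<open>Only meaningful for positive semidefinite arguments, where such a root exists and is unique.\<close>

definition matrix_sqrt :: "real ^ 'n ^ 'n \<Rightarrow> real ^ 'n ^ 'n" where
  "matrix_sqrt M = (THE S. psd_matrix S \<and> S ** S = M)"

definition outer_square :: "real ^ 'n \<Rightarrow> real ^ 'n ^ 'n" where
  "outer_square v = (\<chi> i j. v $ i * v $ j)"

text \<open>
  Mean and covariance of the empirical distribution of the first \<open>N\<close> observations. Dividing by
  \<open>N - 1\<close> in the covariance instead amounts to a rescaling of \<open>\<kappa>\<^sub>1\<close> and \<open>\<kappa>\<^sub>2\<close> below.
\<close>

definition sample_mean :: "nat \<Rightarrow> (nat \<Rightarrow> real ^ 'n) \<Rightarrow> real ^ 'n" where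
  "sample_mean N obs = (1 / real N) *\<^sub>R (\<Sum>k<N. obs k)"

definition sample_cov :: "nat \<Rightarrow> (nat \<Rightarrow> real ^ 'n) \<Rightarrow> real ^ 'n ^ 'n" where
  "sample_cov N obs = (1 / real N) *\<^sub>R (\<Sum>k<N. outer_square (obs k - sample_mean N obs))"

definition borel_prob_measures :: "'a::topological_space set \<Rightarrow> 'a measure set" where
  "borel_prob_measures \<Xi> = {P. prob_space P \<and> sets P = sets (restrict_space borel \<Xi>)}"

definition ambiguity_set ::
  "(real ^ 'n) set \<Rightarrow> real ^ 'n \<Rightarrow> real ^ 'n ^ 'n \<Rightarrow> real \<Rightarrow> real \<Rightarrow> (real ^ 'n) measure set" where
  "ambiguity_set \<Xi> \<mu> \<Sigma> \<kappa>\<^sub>1 \<kappa>\<^sub>2 =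
     {P \<in> borel_prob_measures \<Xi>.
        ((\<integral>\<xi>. \<xi> \<partial>P) - \<mu>) \<bullet> (matrix_inv \<Sigma> *v ((\<integral>\<xi>. \<xi> \<partial>P) - \<mu>)) \<le> \<kappa>\<^sub>1 \<and>
        (\<integral>\<xi>. outer_square (\<xi> - \<mu>) \<partial>P) \<preceq> \<kappa>\<^sub>2 *\<^sub>R \<Sigma>}"

definition cvar :: "real \<Rightarrow> (real ^ ('d::finite + 1)) measure \<Rightarrow> real ^ 'd \<Rightarrow> real" where
  "cvar \<beta> P x = (INF \<alpha>. \<alpha> + (1 / (1 - \<beta>)) * (\<integral>\<xi>. max (- (x \<bullet> part_B \<xi>) - \<alpha>) 0 \<partial>P))"

definition drcvar_obj ::
  "(real ^ ('d::finite + 1)) set \<Rightarrow> real ^ ('d + 1) \<Rightarrow> real ^ ('d + 1) ^ ('d + 1) \<Rightarrow> real \<Rightarrow> real \<Rightarrow>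
   (real \<Rightarrow> real) \<Rightarrow> real \<Rightarrow> real \<Rightarrow> real \<Rightarrow> real ^ 'd \<Rightarrow> real" where
  "drcvar_obj \<Xi> \<mu> \<Sigma> \<kappa>\<^sub>1 \<kappa>\<^sub>2 \<psi> \<tau>\<^sub>1 \<tau>\<^sub>2 \<beta> x =
     (SUP P\<in>ambiguity_set \<Xi> \<mu> \<Sigma> \<kappa>\<^sub>1 \<kappa>\<^sub>2.
        (\<integral>\<xi>. \<psi> (part_a \<xi> - part_B \<xi> \<bullet> x) \<partial>P) + \<tau>\<^sub>1 * (norm x)\<^sup>2 + \<tau>\<^sub>2 * cvar \<beta> P x)"

type_synonym 'd nsdp_var =
  "(real ^ 'd) \<times> real \<times> (real ^ ('d + 1)) \<times> (real ^ ('d + 1) ^ ('d + 1))"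

definition nsdp_feasible :: "'d::finite nsdp_var set" where
  "nsdp_feasible = prob_simplex \<times> UNIV \<times> UNIV \<times> {\<Lambda>. psd_matrix \<Lambda>}"

text \<open>The inner product of \<open>real ^ 'n ^ 'n\<close> is the Frobenius product.\<close>

definition h1 ::
  "real ^ ('d + 1) \<Rightarrow> real ^ ('d + 1) ^ ('d + 1) \<Rightarrow> real \<Rightarrow> real \<Rightarrow> real \<Rightarrow> 'd::finite nsdp_var \<Rightarrow> real"
where
  "h1 \<mu> \<Sigma> \<kappa>\<^sub>2 \<tau>\<^sub>1 \<tau>\<^sub>2 = (\<lambda>(x, \<alpha>, q, \<Lambda>).
     (\<kappa>\<^sub>2 *\<^sub>R \<Sigma>) \<bullet> \<Lambda> + (transpose \<Lambda> *v \<mu> + q) \<bullet> \<mu> + \<tau>\<^sub>1 * (norm x)\<^sup>2 + \<tau>\<^sub>2 * \<alpha>)"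

definition h2 ::
  "(real \<Rightarrow> real) \<Rightarrow> real \<Rightarrow> real \<Rightarrow> real ^ ('d + 1) \<Rightarrow> 'd::finite nsdp_var \<Rightarrow> real" where
  "h2 \<psi> \<tau>\<^sub>2 \<beta> \<xi> = (\<lambda>(x, \<alpha>, q, \<Lambda>).
     \<psi> (part_a \<xi> - part_B \<xi> \<bullet> x) - (transpose \<Lambda> *v \<xi> + q) \<bullet> \<xi>
       + (\<tau>\<^sub>2 / (1 - \<beta>)) * max (- (x \<bullet> part_B \<xi>) - \<alpha>) 0)"

definition h ::
  "real ^ ('d + 1) \<Rightarrow> real ^ ('d + 1) ^ ('d + 1) \<Rightarrow> real \<Rightarrow> real \<Rightarrow> (real \<Rightarrow> real) \<Rightarrow> real \<Rightarrow> real \<Rightarrow> real \<Rightarrow>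
   real ^ ('d + 1) \<Rightarrow> 'd::finite nsdp_var \<Rightarrow> real" where
  "h \<mu> \<Sigma> \<kappa>\<^sub>1 \<kappa>\<^sub>2 \<psi> \<tau>\<^sub>1 \<tau>\<^sub>2 \<beta> \<xi> = (\<lambda>(x, \<alpha>, q, \<Lambda>).
     h1 \<mu> \<Sigma> \<kappa>\<^sub>2 \<tau>\<^sub>1 \<tau>\<^sub>2 (x, \<alpha>, q, \<Lambda>)
       + sqrt \<kappa>\<^sub>1 * norm (matrix_sqrt \<Sigma> *v (q + 2 *\<^sub>R (\<Lambda> *v \<mu>)))
       + h2 \<psi> \<tau>\<^sub>2 \<beta> \<xi> (x, \<alpha>, q, \<Lambda>))"

definition nsdp_obj ::
  "(real ^ ('d + 1)) set \<Rightarrow> real ^ ('d + 1) \<Rightarrow> real ^ ('d + 1) ^ ('d + 1) \<Rightarrow> real \<Rightarrow> real \<Rightarrow>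
   (real \<Rightarrow> real) \<Rightarrow> real \<Rightarrow> real \<Rightarrow> real \<Rightarrow> 'd::finite nsdp_var \<Rightarrow> real" where
  "nsdp_obj \<Xi> \<mu> \<Sigma> \<kappa>\<^sub>1 \<kappa>\<^sub>2 \<psi> \<tau>\<^sub>1 \<tau>\<^sub>2 \<beta> \<nu> = (SUP \<xi>\<in>\<Xi>. h \<mu> \<Sigma> \<kappa>\<^sub>1 \<kappa>\<^sub>2 \<psi> \<tau>\<^sub>1 \<tau>\<^sub>2 \<beta> \<xi> \<nu>)"

end

theory Submission
  imports Defs
begin

text \<open>
  Fix \<open>x\<close>. Weak duality integrates \<open>h\<close> against a measure of the ambiguity set. For the converse,
  evaluate \<open>h\<close> at \<open>\<xi> = \<mu>\<close>, which lies in \<open>\<Xi>\<close>: this alone makes \<open>h\<close> coercive in the dual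
  variables \<open>(\<alpha>, q, \<Lambda>)\<close>. If every dual point had some \<open>\<xi>\<close> with \<open>h\<close> above the primal value,
  compactness would leave finitely many \<open>\<xi>\<close>, and a convex theorem of alternatives would give weights
  on them. The resulting finitely supported measure satisfies the moment constraints, because its
  Lagrangian is bounded below along all dual rays, and it beats the primal value. So the
  minimum over \<open>(\<alpha>, q, \<Lambda>)\<close> is attained and equals the value of \<open>x\<close>.
\<close>

section \<open>Positive semidefinite matrices\<close>

lemma psd_matrix_self_adjoint:
  assumes "psd_matrix A"
  shows "(A *v x) \<bullet> y = x \<bullet> (A *v y)"
  using assms unfolding psd_matrix_def
  by (metis dot_lmul_matrix transpose_matrix_vector)

lemma psd_matrix_nonneg: "psd_matrix A \<Longrightarrow> 0 \<le> v \<bullet> (A *v v)"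
  by (simp add: psd_matrix_def)

lemma pd_matrix_imp_psd: "pd_matrix A \<Longrightarrow> psd_matrix A"
  unfolding pd_matrix_def psd_matrix_def
  by (metis inner_zero_left less_eq_real_def)

lemma transpose_add: "transpose (A + B) = transpose A + transpose (B :: real^'n^'m)"
  by (simp add: transpose_def vec_eq_iff)

lemma transpose_diff: "transpose (A - B) = transpose A - transpose (B :: real^'n^'m)"
  by (simp add: transpose_def vec_eq_iff)

lemma psd_matrix_zero: "psd_matrix 0"
  by (simp add: psd_matrix_def transpose_def vec_eq_iff)

lemma psd_matrix_add: "psd_matrix A \<Longrightarrow> psd_matrix B \<Longrightarrow> psd_matrix (A + B)"
  unfolding psd_matrix_def
  by (simp add: transpose_add matrix_vector_mult_add_rdistrib inner_add_right)

lemma psd_matrix_scaleR: "0 \<le> c \<Longrightarrow> psd_matrix A \<Longrightarrow> psd_matrix (c *\<^sub>R A)"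
  unfolding psd_matrix_def
  by (simp add: transpose_scalar flip: scaleR_matrix_vector_assoc)

lemma outer_square_mult: "outer_square v *v w = (v \<bullet> w) *\<^sub>R v"
  by (simp add: outer_square_def matrix_vector_mult_def inner_vec_def vec_eq_iff
      sum_distrib_left sum_distrib_right mult_ac)

lemma transpose_outer_square: "transpose (outer_square v) = outer_square v"
  by (simp add: outer_square_def transpose_def vec_eq_iff mult.commute)

lemma psd_matrix_outer_square: "psd_matrix (outer_square v)"
  by (simp add: psd_matrix_def transpose_outer_square outer_square_mult inner_commute)

lemma inner_outer_square: "A \<bullet> outer_square v = v \<bullet> (A *v v)"
  by (simp add: outer_square_def matrix_vector_mult_def inner_vec_def sum_distrib_left mult_ac)

text \<open>A nonnegative form that vanishes at \<open>v\<close> is minimal there. Moving by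
  \<open>- t *\<^sub>R w\<close> with \<open>w = A *v v\<close> changes it by
  \<open>t\<^sup>2 * c - 2 * t * (w \<bullet> w)\<close>, which is negative for small positive
  \<open>t\<close> unless \<open>w = 0\<close>.\<close>

lemma psd_matrix_kernel:
  assumes A: "psd_matrix A" and v: "v \<bullet> (A *v v) = 0"
  shows "A *v v = 0"
proof (rule ccontr)
  define w where "w = A *v v"
  define c where "c = w \<bullet> (A *v w)"
  assume "A *v v \<noteq> 0"
  then have ww: "w \<bullet> w > 0" by (simp add: w_def)
  have c: "c \<ge> 0" unfolding c_def using A by (rule psd_matrix_nonneg)
  have ineq: "2 * t * (w \<bullet> w) \<le> t\<^sup>2 * c" for t
  proof -
    have "0 \<le> (v - t *\<^sub>R w) \<bullet> (A *v (v - t *\<^sub>R w))"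
      using A by (rule psd_matrix_nonneg)
    also have "\<dots> = t\<^sup>2 * c - 2 * t * (w \<bullet> w)"
      using psd_matrix_self_adjoint[OF A, of v w] v
      by (simp add: matrix_vector_mult_diff_distrib matrix_vector_mult_scaleR inner_diff_left
          inner_diff_right c_def power2_eq_square algebra_simps flip: w_def)
    finally show ?thesis by simp
  qed
  \<comment> \<open>Adding \<open>1\<close> keeps the denominator positive when \<open>c = 0\<close>
    and still gives \<open>t * c \<le> w \<bullet> w\<close>.\<close>
  define t where "t = (w \<bullet> w) / (c + 1)"
  have t: "t > 0" using ww c by (simp add: t_def)
  have "2 * (w \<bullet> w) \<le> t * c"
    using ineq[of t] t by (simp add: power2_eq_square)
  also have "\<dots> \<le> w \<bullet> w"
    using c ww by (simp add: t_def field_simps)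
  finally show False using ww by simp
qed

section \<open>Squares of symmetric matrices, traces and square roots\<close>

lemma matrix_mult_self_symmetric:
  fixes S :: "real^'n^'n"
  assumes "transpose S = S"
  shows "S ** S = (\<Sum>i\<in>UNIV. outer_square (S $ i))"
proof -
  have "S $ i $ j = S $ j $ i" for i j
    using arg_cong[OF assms, of "\<lambda>M. M $ j $ i"] by (simp add: transpose_def)
  then show ?thesis
    by (simp add: matrix_matrix_mult_def outer_square_def vec_eq_iff)
qed

text \<open>The rank-one splitting of \<open>S ** S\<close> reduces sign questions about Frobenius
  products to values of the quadratic form of \<open>A\<close>.\<close>

lemma inner_matrix_mult_self:
  fixes A S :: "real^'n^'n"
  assumes "transpose S = S"
  shows "A \<bullet> (S ** S) = (\<Sum>i\<in>UNIV. S $ i \<bullet> (A *v (S $ i)))"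
  by (simp add: matrix_mult_self_symmetric[OF assms] inner_sum_right inner_outer_square)

text \<open>The trace form allows cyclic permutation of factors, on which the uniqueness of square
  roots rests.\<close>

lemma inner_eq_trace:
  fixes A B :: "real^'n^'n"
  assumes "transpose A = A"
  shows "A \<bullet> B = trace (A ** B)"
proof -
  have A: "A $ i $ j = A $ j $ i" for i j
    using arg_cong[OF assms, of "\<lambda>M. M $ j $ i"] by (simp add: transpose_def)
  have "A \<bullet> B = (\<Sum>i\<in>UNIV. \<Sum>j\<in>UNIV. A $ i $ j * B $ i $ j)"
    by (simp add: inner_vec_def)
  also have "\<dots> = (\<Sum>j\<in>UNIV. \<Sum>i\<in>UNIV. A $ i $ j * B $ i $ j)"
    by (rule sum.swap)
  finally show ?thesis
    by (simp add: trace_def matrix_matrix_mult_def A)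
qed

text \<open>The product is a sum of nonnegative values of the form of \<open>A\<close> at the rows
  of \<open>D\<close>. All of them vanish, so \<open>A\<close> annihilates every row; by symmetry
  the rows are the columns.\<close>

lemma psd_matrix_self_mult_zero:
  fixes A :: "real^'n^'n"
  assumes A: "psd_matrix A" and D: "transpose D = D" and zero: "A \<bullet> (D ** D) = 0"
  shows "A ** D = 0"
proof -
  have "(\<Sum>i\<in>UNIV. D $ i \<bullet> (A *v (D $ i))) = 0"
    using zero inner_matrix_mult_self[OF D, of A] by simp
  then have "D $ i \<bullet> (A *v (D $ i)) = 0" for i
    using A by (subst (asm) sum_nonneg_eq_0_iff) (auto simp: psd_matrix_nonneg)
  then have *: "A *v (D $ i) = 0" for i
    using A psd_matrix_kernel by blast
  have sym: "D $ i $ j = D $ j $ i" for i j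
    using arg_cong[OF D, of "\<lambda>M. M $ j $ i"] by (simp add: transpose_def)
  have "(A ** D) $ k $ i = (A *v (D $ i)) $ k" for k i
    unfolding matrix_matrix_mult_def matrix_vector_mult_def by (simp add: sym[of _ i])
  then show ?thesis by (simp add: * vec_eq_iff)
qed

lemma symmetric_mult_self_zero:
  fixes D :: "real^'n^'n"
  assumes D: "transpose D = D" and zero: "D ** D = 0"
  shows "D = 0"
proof -
  have "D \<bullet> D = 0"
    using inner_eq_trace[OF D, of D] zero by (simp add: trace_def)
  then show ?thesis by simp
qed

text \<open>With \<open>D = S - T\<close> one has \<open>S D + D T = 0\<close>, so the traces of \<open>D S D\<close> and \<open>D T D\<close>, both
  nonnegative, add up to zero.\<close>

lemma psd_sqrt_unique:
  fixes S T :: "real^'n^'n"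
  assumes S: "psd_matrix S" and T: "psd_matrix T" and eq: "S ** S = T ** T"
  shows "S = T"
proof -
  define D where "D = S - T"
  have tS: "transpose S = S" and tT: "transpose T = T"
    using S T by (simp_all add: psd_matrix_def)
  have D: "transpose D = D" by (simp add: D_def transpose_diff tS tT)
  have sub: "A ** (B - C) = A ** B - A ** C" "(B - C) ** A = B ** A - C ** A"
    for A B C :: "real^'n^'n"
    by (simp_all add: matrix_matrix_mult_def vec_eq_iff algebra_simps sum_subtractf)
  have add: "A ** (B + C) = A ** B + A ** C" for A B C :: "real^'n^'n"
    by (simp add: matrix_matrix_mult_def vec_eq_iff algebra_simps sum.distrib)
  have SDDT: "S ** D + D ** T = 0"
    by (simp add: D_def sub eq)
  have "S \<bullet> (D ** D) = trace (D ** (S ** D))"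
    using trace_mul_sym[of "S ** D" D] by (simp add: inner_eq_trace tS matrix_mul_assoc)
  moreover have "T \<bullet> (D ** D) = trace (D ** (D ** T))"
    using trace_mul_sym[of T "D ** D"] by (simp add: inner_eq_trace tT matrix_mul_assoc)
  ultimately have "S \<bullet> (D ** D) + T \<bullet> (D ** D) = trace (D ** (S ** D)) + trace (D ** (D ** T))"
    by simp
  also have "\<dots> = trace (D ** (S ** D + D ** T))"
    by (simp add: add trace_add)
  also have "\<dots> = 0"
    unfolding SDDT by (simp add: trace_def matrix_matrix_mult_def)
  finally have sum0: "S \<bullet> (D ** D) + T \<bullet> (D ** D) = 0" .
  have "0 \<le> S \<bullet> (D ** D)" "0 \<le> T \<bullet> (D ** D)"
    unfolding inner_matrix_mult_self[OF D] using S T by (simp_all add: sum_nonneg psd_matrix_nonneg)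
  with sum0 have "S ** D = 0" "T ** D = 0"
    using S T D by (auto intro!: psd_matrix_self_mult_zero)
  then have "D ** D = 0" by (simp add: D_def sub)
  then show ?thesis using symmetric_mult_self_zero[OF D] by (simp add: D_def)
qed

text \<open>The form attains its maximum \<open>l\<close> on the unit sphere at some
  \<open>v\<close>. Then \<open>mat l - A\<close> is positive semidefinite and its form vanishes at
  \<open>v\<close>, so \<open>v\<close> lies in its kernel.\<close>

lemma psd_matrix_top_eigenvector:
  fixes A :: "real^'n^'n"
  assumes A: "psd_matrix A" and nz: "A \<noteq> 0"
  obtains v l where "v \<bullet> v = 1" "A *v v = l *\<^sub>R v" "l > 0"
proof -
  obtain e :: "real^'n" where e: "e \<in> sphere 0 1"
    by (meson ex_in_conv sphere_eq_empty not_one_less_zero)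
  have cont: "continuous_on (sphere 0 1) (\<lambda>v. v \<bullet> (A *v v))"
    by (intro continuous_intros)
  have "sphere 0 1 \<noteq> ({} :: (real^'n) set)" using e by blast
  from continuous_attains_sup[OF compact_sphere this cont]
  obtain v where v: "v \<in> sphere 0 1"
    and max: "\<And>w. w \<in> sphere 0 1 \<Longrightarrow> w \<bullet> (A *v w) \<le> v \<bullet> (A *v v)"
    by auto
  define l where "l = v \<bullet> (A *v v)"
  have vv: "v \<bullet> v = 1" using v by (simp add: norm_eq_1)
  have bound: "w \<bullet> (A *v w) \<le> l * (w \<bullet> w)" for w
  proof (cases "w = 0")
    case False
    define u where "u = (1 / norm w) *\<^sub>R w"
    have "u \<in> sphere 0 1" using False by (simp add: u_def)
    from max[OF this] have "(w \<bullet> (A *v w)) / (norm w)\<^sup>2 \<le> l"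
      by (simp add: u_def l_def matrix_vector_mult_scaleR power2_eq_square)
    then show ?thesis
      using False by (simp add: field_simps power2_norm_eq_inner)
  qed simp
  define B where "B = mat l - A"
  have Bmult: "B *v w = l *\<^sub>R w - A *v w" for w
  proof -
    have "mat l *v w = l *\<^sub>R w"
      by (simp add: mat_def matrix_vector_mult_def vec_eq_iff if_distrib if_distribR cong: if_cong)
    then show ?thesis by (simp add: B_def matrix_vector_mult_diff_rdistrib)
  qed
  have "transpose B = B" using A by (simp add: B_def transpose_diff psd_matrix_def)
  then have "psd_matrix B"
    unfolding psd_matrix_def using bound by (simp add: Bmult inner_diff_right)
  moreover have "v \<bullet> (B *v v) = 0"
    by (simp add: Bmult inner_diff_right vv l_def)
  ultimately have "B *v v = 0" by (rule psd_matrix_kernel)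
  then have Av: "A *v v = l *\<^sub>R v" by (simp add: Bmult)
  have "l \<noteq> 0"
  proof
    assume "l = 0"
    then have "w \<bullet> (A *v w) = 0" for w
      using bound[of w] psd_matrix_nonneg[OF A, of w] by simp
    then have "A *v w = 0" for w using A psd_matrix_kernel by blast
    then show False using nz by (simp add: matrix_eq)
  qed
  moreover have "l \<ge> 0" unfolding l_def using A by (rule psd_matrix_nonneg)
  ultimately have "l > 0" by simp
  with vv Av show ?thesis by (rule that)
qed

text \<open>Splitting off a top eigenvector \<open>v\<close> leaves a positive semidefinite matrix of larger kernel,
  whose root annihilates \<open>v\<close>.\<close>

lemma psd_sqrt_exists:
  fixes A :: "real^'n^'n"
  assumes "psd_matrix A"
  shows "\<exists>S. psd_matrix S \<and> S ** S = A"
  using assms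
proof (induction "CARD('n) - dim {w. A *v w = 0}" arbitrary: A rule: less_induct)
  \<comment> \<open>The induction runs on the rank of \<open>A\<close>, written as dimension minus
    nullity.\<close>
  case less
  show ?case
  proof (cases "A = 0")
    case True
    then show ?thesis
      by (intro exI[of _ 0]) (simp add: psd_matrix_zero matrix_matrix_mult_def vec_eq_iff)
  next
    case False
    obtain v l where vv: "v \<bullet> v = 1" and Av: "A *v v = l *\<^sub>R v" and l: "l > 0"
      using psd_matrix_top_eigenvector[OF less.prems False] by blast
    define A' where "A' = A - l *\<^sub>R outer_square v"
    have A': "A' *v w = A *v w - (l * (v \<bullet> w)) *\<^sub>R v" for w
      by (simp add: A'_def matrix_vector_mult_diff_rdistrib outer_square_mult
          flip: scaleR_matrix_vector_assoc)
    have A'v: "A' *v v = 0" by (simp add: A' Av vv)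
    have symA: "transpose A = A" using less.prems by (simp add: psd_matrix_def)
    have tA': "transpose A' = A'"
      by (simp add: A'_def transpose_diff transpose_scalar transpose_outer_square symA)
    have psd': "psd_matrix A'"
      unfolding psd_matrix_def
    proof (intro conjI allI tA')
      fix w
      \<comment> \<open>\<open>A'\<close> kills \<open>v\<close> and agrees with \<open>A\<close> on
        the orthogonal complement of \<open>v\<close>, so only this component of \<open>w\<close>
        matters.\<close>
      define u where "u = w - (v \<bullet> w) *\<^sub>R v"
      have vu: "v \<bullet> u = 0" by (simp add: u_def inner_diff_right vv)
      have "A' *v w = A' *v u"
        by (simp add: u_def matrix_vector_mult_diff_distrib matrix_vector_mult_scaleR A'v)
      also have "\<dots> = A *v u" by (simp add: A' vu)
      finally have "A' *v w = A *v u" .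
      moreover have "v \<bullet> (A *v u) = 0"
        using psd_matrix_self_adjoint[OF less.prems, of v u] by (simp add: Av vu)
      ultimately have "w \<bullet> (A' *v w) = u \<bullet> (A *v u)"
        by (simp add: u_def inner_diff_left)
      then show "0 \<le> w \<bullet> (A' *v w)" using psd_matrix_nonneg[OF less.prems] by simp
    qed
    have sub: "subspace {w. M *v w = 0}" for M :: "real^'n^'n"
      by (auto simp: subspace_def matrix_vector_right_distrib matrix_vector_mult_scaleR)
    have ker: "A' *v w = 0" if "A *v w = 0" for w
    proof -
      have "l * (v \<bullet> w) = 0"
        using psd_matrix_self_adjoint[OF less.prems, of v w] that by (simp add: Av)
      then show ?thesis using that by (simp add: A')
    qed
    have "v \<noteq> 0" using vv by auto
    then have "A *v v \<noteq> 0" using l by (simp add: Av)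
    then have "{w. A *v w = 0} \<subset> {w. A' *v w = 0}" using ker A'v by blast
    then have "dim {w. A *v w = 0} < dim {w. A' *v w = 0}"
      by (intro dim_psubset) (simp add: span_eq_iff[THEN iffD2, OF sub])
    moreover have "dim {w. A' *v w = 0} \<le> CARD('n)"
      using dim_subset_UNIV[of "{w. A' *v w = 0}"] by simp
    ultimately obtain S where S: "psd_matrix S" "S ** S = A'"
      using less.hyps[OF _ psd'] by force
    \<comment> \<open>The mixed terms of \<open>T ** T\<close> vanish because
      \<open>S *v v = 0\<close> and the range of \<open>S\<close> is orthogonal to
      \<open>v\<close>.\<close>
    define T where "T = S + sqrt l *\<^sub>R outer_square v"
    have "(S *v v) \<bullet> (S *v v) = 0"
      using psd_matrix_self_adjoint[OF S(1), of v "S *v v"]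
      by (simp add: matrix_vector_mul_assoc S(2) A'v)
    then have Sv: "S *v v = 0" by simp
    have vS: "v \<bullet> (S *v w) = 0" for w
      using psd_matrix_self_adjoint[OF S(1), of v w] by (simp add: Sv)
    have "T *v (T *v w) = A *v w" for w
    proof -
      have T: "T *v w = S *v w + (sqrt l * (v \<bullet> w)) *\<^sub>R v" for w
        by (simp add: T_def matrix_vector_mult_add_rdistrib outer_square_mult
            flip: scaleR_matrix_vector_assoc)
      have "T *v (T *v w) = S *v (S *v w) + (sqrt l * (sqrt l * (v \<bullet> w))) *\<^sub>R v"
        unfolding T by (simp add: matrix_vector_right_distrib matrix_vector_mult_scaleR Sv
            inner_add_right vS vv)
      also have "\<dots> = A *v w"
        using l by (simp add: matrix_vector_mul_assoc S(2) A' flip: mult.assoc)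
      finally show ?thesis .
    qed
    then have "T ** T = A" by (simp add: matrix_eq matrix_vector_mul_assoc)
    moreover have "psd_matrix T"
      unfolding T_def using l S(1)
      by (intro psd_matrix_add psd_matrix_scaleR psd_matrix_outer_square) simp_all
    ultimately show ?thesis by (intro exI[of _ T]) simp
  qed
qed

section \<open>The cone of positive semidefinite matrices\<close>

lemma matrix_sqrt:
  assumes "psd_matrix A"
  shows "psd_matrix (matrix_sqrt A)" "matrix_sqrt A ** matrix_sqrt A = A"
proof -
  have "\<exists>!S. psd_matrix S \<and> S ** S = A"
    using psd_sqrt_exists[OF assms] psd_sqrt_unique by metis
  from theI'[OF this] show "psd_matrix (matrix_sqrt A)" "matrix_sqrt A ** matrix_sqrt A = A"
    unfolding matrix_sqrt_def by auto
qed

lemma norm_matrix_sqrt: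
  assumes "psd_matrix A"
  shows "(norm (matrix_sqrt A *v v))\<^sup>2 = v \<bullet> (A *v v)"
  using psd_matrix_self_adjoint[OF matrix_sqrt(1)[OF assms]] matrix_sqrt(2)[OF assms]
  by (simp add: power2_norm_eq_inner matrix_vector_mul_assoc)

text \<open>With \<open>B\<close> written as the square of its root, the product is a sum of values
  of the form of \<open>A\<close>. This is one half of the self-duality of the cone.\<close>

lemma psd_matrix_inner_nonneg:
  assumes A: "psd_matrix A" and B: "psd_matrix B"
  shows "0 \<le> A \<bullet> B"
proof -
  have "transpose (matrix_sqrt B) = matrix_sqrt B"
    using matrix_sqrt(1)[OF B] by (simp add: psd_matrix_def)
  from inner_matrix_mult_self[OF this, of A] show ?thesis
    using A by (simp add: matrix_sqrt(2)[OF B] sum_nonneg psd_matrix_nonneg)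
qed

text \<open>The root of a nonzero \<open>B\<close> has a nonzero row, which contributes a positive
  value.\<close>

lemma pd_matrix_inner_pos:
  fixes A :: "real^'n^'n"
  assumes A: "pd_matrix A" and B: "psd_matrix B" and nz: "B \<noteq> 0"
  shows "0 < A \<bullet> B"
proof -
  define S where "S = matrix_sqrt B"
  have S: "transpose S = S" and SS: "S ** S = B"
    using matrix_sqrt[OF B] by (simp_all add: psd_matrix_def S_def)
  have "S \<noteq> 0" using SS nz by (auto simp: matrix_matrix_mult_def zero_vec_def)
  then obtain i where "S $ i \<noteq> 0" by (auto simp: vec_eq_iff)
  then have "0 < S $ i \<bullet> (A *v (S $ i))" using A by (simp add: pd_matrix_def)
  also have "\<dots> \<le> (\<Sum>i\<in>UNIV. S $ i \<bullet> (A *v (S $ i)))"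
    using psd_matrix_nonneg[OF pd_matrix_imp_psd[OF A]] by (intro member_le_sum) auto
  finally show ?thesis
    using inner_matrix_mult_self[OF S, of A] by (simp add: SS)
qed

lemma closed_psd_matrix: "closed {A :: real^'n^'n. psd_matrix A}"
proof -
  have "closed {A :: real^'n^'n. transpose A = A}"
    unfolding transpose_def vec_eq_iff vec_lambda_beta
    by (intro closed_Collect_all closed_Collect_eq continuous_intros)
  \<comment> \<open>As a Frobenius product with a fixed matrix, the form is visibly continuous in
    \<open>A\<close>.\<close>
  moreover have "closed {A :: real^'n^'n. 0 \<le> v \<bullet> (A *v v)}" for v
    unfolding inner_outer_square[symmetric]
    by (intro closed_Collect_le continuous_intros)
  ultimately show ?thesis
    unfolding psd_matrix_def by (intro closed_Collect_conj closed_Collect_all)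
qed

lemma convex_psd_matrix: "convex {A :: real^'n^'n. psd_matrix A}"
  by (auto simp: convex_def intro!: psd_matrix_add psd_matrix_scaleR)

text \<open>A positive minimum on the compact unit slice of the cone extends by homogeneity. It
  later bounds the multiplier \<Lambda>.\<close>

lemma pd_matrix_coercive:
  fixes A :: "real^'n^'n"
  assumes A: "pd_matrix A"
  obtains c where "c > 0" "\<And>B. psd_matrix B \<Longrightarrow> c * norm B \<le> A \<bullet> B"
proof -
  define K where "K = sphere 0 1 \<inter> {B :: real^'n^'n. psd_matrix B}"
  have K: "compact K" unfolding K_def by (intro compact_Int_closed closed_psd_matrix) simp
  obtain c where c: "c > 0" "\<And>B. B \<in> K \<Longrightarrow> c \<le> A \<bullet> B"
  proof (cases "K = {}")
    case True
    then show ?thesis using that[of 1] by simp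
  next
    case False
    have "continuous_on K ((\<bullet>) A)" by (intro continuous_intros)
    then obtain B where B: "B \<in> K" "\<And>C. C \<in> K \<Longrightarrow> A \<bullet> B \<le> A \<bullet> C"
      using continuous_attains_inf[OF K False] by blast
    have "B \<noteq> 0" "psd_matrix B" using B(1) by (auto simp: K_def)
    then have "A \<bullet> B > 0" using pd_matrix_inner_pos[OF A] by blast
    then show ?thesis using that B(2) by blast
  qed
  show ?thesis
  proof (rule that[OF c(1)])
    fix B :: "real^'n^'n" assume B: "psd_matrix B"
    show "c * norm B \<le> A \<bullet> B"
    proof (cases "B = 0")
      case False
      have "(1 / norm B) *\<^sub>R B \<in> K"
        using False B by (auto simp: K_def intro!: psd_matrix_scaleR)
      from c(2)[OF this] show ?thesis using False by (simp add: field_simps)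
    qed simp
  qed
qed

text \<open>The root is injective because \<open>norm_matrix_sqrt\<close> ties its norm to a
  positive definite form. The constant later bounds the multiplier \<open>r\<close>.\<close>

lemma pd_matrix_sqrt_bounded_below:
  fixes A :: "real^'n^'n"
  assumes A: "pd_matrix A"
  obtains c where "c > 0" "\<And>v. c * norm v \<le> norm (matrix_sqrt A *v v)"
proof -
  have "matrix_sqrt A *v v \<noteq> 0" if "v \<noteq> 0" for v
    using norm_matrix_sqrt[OF pd_matrix_imp_psd[OF A], of v] A that
    by (auto simp: pd_matrix_def)
  then have "inj ((*v) (matrix_sqrt A))"
    by (metis linear_injective_0 matrix_vector_mul_linear)
  then obtain c where "c > 0" "\<And>v. norm (matrix_sqrt A *v v) \<ge> c * norm v"
    using linear_inj_bounded_below_pos[OF matrix_vector_mul_linear] by metis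
  then show ?thesis using that by blast
qed

text \<open>\<open>matrix_inv\<close> is a choice of two-sided inverse, so invertibility comes
  first, from definiteness.\<close>

lemma pd_matrix_inv:
  fixes A :: "real^'n^'n"
  assumes A: "pd_matrix A"
  shows "A *v (matrix_inv A *v v) = v"
proof -
  have "inj ((*v) A)"
    using A by (metis inner_zero_right less_irrefl linear_injective_0 matrix_vector_mul_linear
        pd_matrix_def)
  then have "invertible A"
    by (simp add: invertible_left_inverse matrix_left_invertible_injective)
  then have "\<exists>B. A ** B = mat 1 \<and> B ** A = mat 1" by (simp add: invertible_def)
  then have "A ** matrix_inv A = mat 1"
    unfolding matrix_inv_def by (rule someI2_ex) simp
  then show ?thesis by (simp add: matrix_vector_mul_assoc)
qed

section \<open>A finite minimax theorem\<close>

text \<open>Reads sign conditions off rays, both for separating normals and for the moment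
  constraints.\<close>

lemma nonneg_if_affine_bounded_below:
  fixes k d c :: real
  assumes "\<And>s. s \<ge> 0 \<Longrightarrow> c \<le> k * s + d"
  shows "0 \<le> k"
proof (rule ccontr)
  assume k: "\<not> 0 \<le> k"
  \<comment> \<open>Chosen so that \<open>k * s + d\<close> is at most \<open>c - 1\<close>.\<close>
  define s where "s = (\<bar>d - c\<bar> + 1) / (- k)"
  have "s \<ge> 0" "k * s = - (\<bar>d - c\<bar> + 1)" using k by (auto simp: s_def field_simps)
  with assms[of s] show False by linarith
qed

text \<open>Separate the pairs dominating some \<open>(f x, g x)\<close> from the open negative
  quadrant. Upward closure makes the normal nonnegative, closeness of the quadrant to the origin
  makes the level nonnegative, and rescaling turns the normal into weights.\<close>

lemma convex_alternative_two:
  fixes f g :: "'a::real_vector \<Rightarrow> real"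
  assumes f: "convex_on C f" and g: "convex_on C g"
    and alt: "\<And>x. x \<in> C \<Longrightarrow> f x < 0 \<Longrightarrow> g x \<ge> 0"
  obtains a b where "0 \<le> a" "0 \<le> b" "a + b = (1::real)"
    "\<And>x. x \<in> C \<Longrightarrow> 0 \<le> a * f x + b * g x"
proof (cases "C = {}")
  case True
  then show ?thesis using that[of 0 1] by simp
next
  case False
  \<comment> \<open>Taking all dominating pairs gives a convex set, although the image of
    \<open>C\<close> itself may fail to be convex.\<close>
  define A where "A = {(s, t). \<exists>x\<in>C. f x \<le> s \<and> g x \<le> t}"
  define B where "B = {..<0::real} \<times> {..<0::real}"
  have "convex A"
    unfolding convex_def
  proof (intro ballI allI impI)
    fix y z :: "real \<times> real" and u v :: real
    assume yz: "y \<in> A" "z \<in> A" and uv: "0 \<le> u" "0 \<le> v" "u + v = 1"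
    obtain p q where p: "p \<in> C" "f p \<le> fst y" "g p \<le> snd y"
      and q: "q \<in> C" "f q \<le> fst z" "g q \<le> snd z"
      using yz by (auto simp: A_def)
    let ?x = "u *\<^sub>R p + v *\<^sub>R q"
    have mono: "u * h p + v * h q \<le> u * s + v * t" if "h p \<le> s" "h q \<le> t"
      for h :: "'a \<Rightarrow> real" and s t
      using that uv by (intro add_mono mult_left_mono)
    have "?x \<in> C" using convexD[OF convex_on_imp_convex[OF f]] p(1) q(1) uv by blast
    moreover have "f ?x \<le> u * fst y + v * fst z" "g ?x \<le> u * snd y + v * snd z"
      using convex_on_imp_convex[OF f] f g p q uv mono[of f] mono[of g]
      unfolding convex_on_def by (meson order_trans)+
    ultimately have "(u * fst y + v * fst z, u * snd y + v * snd z) \<in> A"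
      unfolding A_def by blast
    moreover have "u *\<^sub>R y + v *\<^sub>R z = (u * fst y + v * fst z, u * snd y + v * snd z)"
      by (simp add: prod_eq_iff)
    ultimately show "u *\<^sub>R y + v *\<^sub>R z \<in> A" by simp
  qed
  moreover have "convex B" unfolding B_def by (intro convex_Times) auto
  moreover have "A \<noteq> {}" using False by (auto simp: A_def)
  moreover have "B \<noteq> {}" by (auto simp: B_def intro!: exI[of _ "-1"])
  moreover have "B \<inter> A = {}" using alt by (fastforce simp: A_def B_def)
  ultimately obtain n c where n: "n \<noteq> 0"
    and nB: "\<And>y. y \<in> B \<Longrightarrow> n \<bullet> y \<le> c" and nA: "\<And>y. y \<in> A \<Longrightarrow> c \<le> n \<bullet> y"
    using separating_hyperplane_sets[of B A] by metis
  obtain p q where pq: "n = (p, q)" by (cases n)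
  have Bc: "p * s + q * t \<le> c" if "s < 0" "t < 0" for s t
    using nB[of "(s, t)"] that by (simp add: B_def pq)
  have Ac: "c \<le> p * s + q * t" if "x \<in> C" "f x \<le> s" "g x \<le> t" for x s t
    using nA[of "(s, t)"] that by (auto simp: A_def pq)
  \<comment> \<open>The points \<open>(s, s)\<close> with \<open>s\<close> tending to
    \<open>0\<close> from below lie in \<open>B\<close>.\<close>
  have c: "0 \<le> c"
  proof (rule tendsto_le[OF trivial_limit_at_left_real tendsto_const])
    have "((\<lambda>s. p * s + q * s) \<longlongrightarrow> p * 0 + q * 0) (at_left (0::real))"
      by (intro tendsto_intros)
    then show "((\<lambda>s. p * s + q * s) \<longlongrightarrow> 0) (at_left (0::real))" by simp
    show "\<forall>\<^sub>F s in at_left 0. p * s + q * s \<le> c"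
      using Bc by (intro eventually_at_leftI[of "-1"]) auto
  qed
  obtain x0 where x0: "x0 \<in> C" using False by blast
  have p: "0 \<le> p"
  proof (rule nonneg_if_affine_bounded_below)
    fix s :: real assume "s \<ge> 0"
    then show "c \<le> p * s + (p * f x0 + q * g x0)"
      using Ac[OF x0, of "f x0 + s" "g x0"] by (simp add: algebra_simps)
  qed
  have q: "0 \<le> q"
  proof (rule nonneg_if_affine_bounded_below)
    fix s :: real assume "s \<ge> 0"
    then show "c \<le> q * s + (p * f x0 + q * g x0)"
      using Ac[OF x0, of "f x0" "g x0 + s"] by (simp add: algebra_simps)
  qed
  have pos: "p + q > 0" using n p q by (auto simp: pq zero_prod_def)
  show ?thesis
  proof (rule that[of "p / (p + q)" "q / (p + q)"])
    fix x assume "x \<in> C"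
    then have "0 \<le> (p * f x + q * g x) / (p + q)"
      using Ac[of x "f x" "g x"] c pos by (intro divide_nonneg_pos) auto
    then show "0 \<le> p / (p + q) * f x + q / (p + q) * g x" by (simp add: add_divide_distrib)
  qed (use p q pos in \<open>auto simp flip: add_divide_distrib\<close>)
qed

lemma convex_sublevel_strict:
  assumes "convex_on C f"
  shows "convex {x \<in> C. f x < (t::real)}"
proof -
  have "f (u *\<^sub>R x + v *\<^sub>R y) < t"
    if "x \<in> C" "y \<in> C" "f x < t" "f y < t" "0 \<le> u" "0 \<le> v" "u + v = 1" for x y u v
  proof -
    have "f (u *\<^sub>R x + v *\<^sub>R y) \<le> u * f x + v * f y"
      using assms that unfolding convex_on_def by blast
    also have "\<dots> < t" using that by (intro convex_bound_lt)
    finally show ?thesis .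
  qed
  then show ?thesis
    using convex_on_imp_convex[OF assms] by (auto simp: convex_def)
qed

lemma convex_on_weighted_sum:
  fixes f :: "'i \<Rightarrow> 'a::real_vector \<Rightarrow> real"
  assumes "finite I" "convex C" "\<And>i. i \<in> I \<Longrightarrow> 0 \<le> w i" "\<And>i. i \<in> I \<Longrightarrow> convex_on C (f i)"
  shows "convex_on C (\<lambda>x. \<Sum>i\<in>I. w i * f i x)"
  using assms
proof (induction I rule: finite_induct)
  case empty
  then show ?case by (simp add: convex_on_const)
next
  case (insert i I)
  then show ?case by (simp add: convex_on_add convex_on_cmul)
qed

text \<open>Restricting to the part of \<open>C\<close> where the new function is negative reduces the claim to
  the remaining functions, whose combination is then paired with the new one.\<close>

lemma convex_alternative:
  fixes f :: "'i \<Rightarrow> 'a::real_vector \<Rightarrow> real"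
  assumes "finite I" "I \<noteq> {}" "convex C" "\<And>i. i \<in> I \<Longrightarrow> convex_on C (f i)"
    and "\<And>x. x \<in> C \<Longrightarrow> \<exists>i\<in>I. 0 \<le> f i x"
  shows "\<exists>w. (\<forall>i\<in>I. 0 \<le> w i) \<and> sum w I = 1 \<and> (\<forall>x\<in>C. 0 \<le> (\<Sum>i\<in>I. w i * f i x))"
  using assms
proof (induction I arbitrary: C rule: finite_ne_induct)
  case (singleton i)
  then show ?case by (intro exI[of _ "\<lambda>_. 1"]) simp
next
  case (insert j I)
  define D where "D = {x \<in> C. f j x < 0}"
  have D: "convex D" "D \<subseteq> C"
    using insert.prems(2)[of j] by (auto simp: D_def intro: convex_sublevel_strict)
  have "\<exists>w. (\<forall>i\<in>I. 0 \<le> w i) \<and> sum w I = 1 \<and> (\<forall>x\<in>D. 0 \<le> (\<Sum>i\<in>I. w i * f i x))"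
  proof (rule insert.IH[OF D(1)])
    show "convex_on D (f i)" if "i \<in> I" for i
      using insert.prems(2)[of i] that D by (auto intro: convex_on_subset)
    show "\<exists>i\<in>I. 0 \<le> f i x" if "x \<in> D" for x
      using insert.prems(3)[of x] that by (auto simp: D_def)
  qed
  then obtain w where w: "\<And>i. i \<in> I \<Longrightarrow> 0 \<le> w i" "sum w I = 1"
    "\<And>x. x \<in> D \<Longrightarrow> 0 \<le> (\<Sum>i\<in>I. w i * f i x)" by blast
  have F: "convex_on C (\<lambda>x. \<Sum>i\<in>I. w i * f i x)"
    using insert.hyps(1) insert.prems w(1) by (intro convex_on_weighted_sum) auto
  have "0 \<le> (\<Sum>i\<in>I. w i * f i x)" if "x \<in> C" "f j x < 0" for x
    using w(3) that by (simp add: D_def)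
  from convex_alternative_two[OF insert.prems(2)[OF insertI1] F this]
  obtain a b where ab: "0 \<le> a" "0 \<le> b" "a + b = 1"
    and pos: "\<And>x. x \<in> C \<Longrightarrow> 0 \<le> a * f j x + b * (\<Sum>i\<in>I. w i * f i x)"
    by blast
  define w' where "w' = (\<lambda>i. if i = j then a else b * w i)"
  have sum: "(\<Sum>i\<in>insert j I. w' i * h i) = a * h j + b * (\<Sum>i\<in>I. w i * h i)" for h
  proof -
    have "(\<Sum>i\<in>I. w' i * h i) = (\<Sum>i\<in>I. b * w i * h i)"
      using insert.hyps(3) by (intro sum.cong) (auto simp: w'_def)
    then show ?thesis
      using insert.hyps by (simp add: w'_def sum_distrib_left mult.assoc)
  qed
  show ?case
  proof (intro exI[of _ w'] conjI ballI)
    show "0 \<le> w' i" if "i \<in> insert j I" for i using that ab w(1) by (auto simp: w'_def)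
    show "sum w' (insert j I) = 1" using sum[of "\<lambda>_. 1"] w(2) ab by simp
    show "0 \<le> (\<Sum>i\<in>insert j I. w' i * f i x)" if "x \<in> C" for x
      using pos[OF that] by (simp add: sum)
  qed
qed

text \<open>By the finite intersection property, finitely many pairs of a function and a level above
  \<open>v\<close> cover the compact sublevel set \<open>K\<close>; outside it \<open>f i0\<close>
  exceeds \<open>t0\<close>. The least of these levels is one \<open>t\<close> that suits every
  point, and the alternative is applied to the functions minus \<open>t\<close>.\<close>

lemma convex_minimax_finite:
  fixes f :: "'i \<Rightarrow> 'a::real_normed_vector \<Rightarrow> real"
  assumes C: "convex C" "closed C"
    and conv: "\<And>i. i \<in> I \<Longrightarrow> convex_on C (f i)"
    and cont: "\<And>i. i \<in> I \<Longrightarrow> continuous_on C (f i)"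
    and i0: "i0 \<in> I" and t0: "v < t0" and comp: "compact {x \<in> C. f i0 x \<le> t0}"
    and gt: "\<And>x. x \<in> C \<Longrightarrow> \<exists>i\<in>I. v < f i x"
  obtains t J w where "v < t" "finite J" "J \<subseteq> I" "\<And>i. i \<in> J \<Longrightarrow> 0 \<le> w i" "sum w J = 1"
    "\<And>x. x \<in> C \<Longrightarrow> t \<le> (\<Sum>i\<in>J. w i * f i x)"
proof -
  define K where "K = {x \<in> C. f i0 x \<le> t0}"
  define F where "F = (\<lambda>(i, t). {x \<in> C. f i x \<le> t})"
  have "closed (F k)" if "k \<in> I \<times> {v<..}" for k
    using that C(2) cont
    by (auto simp: F_def intro!: continuous_on_closed_Collect_le continuous_on_const)
  moreover have "K \<inter> (\<Inter>k\<in>I \<times> {v<..}. F k) = {}"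
  proof -
    have False if "x \<in> K" and x: "\<forall>k\<in>I \<times> {v<..}. x \<in> F k" for x
    proof -
      obtain i where i: "i \<in> I" "v < f i x" using gt \<open>x \<in> K\<close> by (auto simp: K_def)
      obtain t where "v < t" "t < f i x" using dense[OF i(2)] by blast
      then show False using x i by (force simp: F_def)
    qed
    then show ?thesis by blast
  qed
  ultimately obtain G where G: "finite G" "G \<subseteq> I \<times> {v<..}" "K \<inter> (\<Inter>k\<in>G. F k) = {}"
    using compact_imp_fip_image[of K "I \<times> {v<..}" F] comp unfolding K_def by blast
  \<comment> \<open>\<open>i0\<close> takes care of the points outside \<open>K\<close>.\<close>
  define J where "J = insert i0 (fst ` G)"
  define t where "t = Min (insert t0 (snd ` G))"
  have t_le: "t \<le> t0" "\<And>i s. (i, s) \<in> G \<Longrightarrow> t \<le> s"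
    using G(1) by (auto simp: t_def intro!: Min_le image_eqI[of _ snd])
  have vt: "v < t" using G(1,2) t0 by (auto simp: t_def)
  have J: "finite J" "J \<noteq> {}" "J \<subseteq> I" using G i0 by (auto simp: J_def)
  have ge: "\<exists>i\<in>J. 0 \<le> f i x - t" if x: "x \<in> C" for x
  proof (cases "x \<in> K")
    case True
    then obtain i s where "(i, s) \<in> G" "x \<notin> F (i, s)" using G(3) by fastforce
    then have "s < f i x" "i \<in> J" "t \<le> s" using x t_le by (force simp: F_def J_def)+
    then show ?thesis by (intro bexI[of _ i]) auto
  next
    case False
    then show ?thesis using x t_le(1) by (intro bexI[of _ i0]) (auto simp: K_def J_def)
  qed
  have "convex_on C (\<lambda>x. f i x - t)" if "i \<in> J" for i
    using convex_on_add[OF conv, of i "\<lambda>_. - t"] J(3) that C(1) by (auto simp: convex_on_const)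
  from convex_alternative[OF J(1,2) C(1) this ge]
  obtain w where w: "\<forall>i\<in>J. 0 \<le> w i" "sum w J = 1" "\<forall>x\<in>C. 0 \<le> (\<Sum>i\<in>J. w i * (f i x - t))"
    by blast
  have "(\<Sum>i\<in>J. w i * (f i x - t)) = (\<Sum>i\<in>J. w i * f i x) - t" for x
    by (simp add: right_diff_distrib sum_subtractf w(2) flip: sum_distrib_right)
  then show ?thesis using that[OF vt J(1,3), of w] w by simp
qed

section \<open>Duality for the moment problem\<close>

lemma space_borel_prob_measures:
  "P \<in> borel_prob_measures \<Xi> \<Longrightarrow> space P = \<Xi>"
  using sets_eq_imp_space_eq[of P "restrict_space borel \<Xi>"]
  by (simp add: borel_prob_measures_def space_restrict_space)

lemma prob_space_borel_prob_measures:
  "P \<in> borel_prob_measures \<Xi> \<Longrightarrow> prob_space P"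
  by (simp add: borel_prob_measures_def)

lemma integrable_continuous_on_compact:
  fixes f :: "'a::euclidean_space \<Rightarrow> 'b::euclidean_space"
  assumes P: "P \<in> borel_prob_measures \<Xi>" and \<Xi>: "compact \<Xi>" and f: "continuous_on \<Xi> f"
  shows "integrable P f"
proof -
  interpret prob_space P using P by (rule prob_space_borel_prob_measures)
  have "bounded (f ` \<Xi>)" using compact_continuous_image[OF f \<Xi>] by (rule compact_imp_bounded)
  then obtain B where B: "\<And>x. x \<in> \<Xi> \<Longrightarrow> norm (f x) \<le> B" by (auto simp: bounded_iff)
  have "f \<in> borel_measurable (restrict_space borel \<Xi>)"
    using f by (rule borel_measurable_continuous_on_restrict)
  then have "f \<in> borel_measurable P"
    using P by (simp add: borel_prob_measures_def cong: measurable_cong_sets)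
  then show ?thesis
    using B space_borel_prob_measures[OF P] by (intro integrable_const_bound[of _ B]) auto
qed

text \<open>Pushing a point measure on \<open>J\<close> forward along the inclusion gives the
  required sigma-algebra. Continuity of \<open>f\<close> supplies measurability for the change of
  variables.\<close>

lemma finitely_supported_borel_prob_measure:
  fixes \<Xi> :: "'a::euclidean_space set"
  assumes J: "finite J" "J \<subseteq> \<Xi>" and w: "\<And>j. j \<in> J \<Longrightarrow> 0 \<le> w j" "sum w J = (1::real)"
  obtains P where "P \<in> borel_prob_measures \<Xi>"
    "\<And>f :: 'a \<Rightarrow> real. continuous_on \<Xi> f \<Longrightarrow> (\<integral>x. f x \<partial>P) = (\<Sum>j\<in>J. w j * f j)"
proof -
  define P where "P = distr (point_measure J w) (restrict_space borel \<Xi>) (\<lambda>x. x)"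
  have meas: "(\<lambda>x. x) \<in> measurable (point_measure J w) (restrict_space borel \<Xi>)"
    using J by (auto simp: space_restrict_space)
  have "prob_space (point_measure J w)"
    using J w by (intro prob_spaceI)
      (simp add: space_point_measure emeasure_point_measure_finite sum_ennreal)
  then have "prob_space P" unfolding P_def by (rule prob_space.prob_space_distr[OF _ meas])
  then have "P \<in> borel_prob_measures \<Xi>" by (simp add: borel_prob_measures_def P_def)
  moreover have "(\<integral>x. f x \<partial>P) = (\<Sum>j\<in>J. w j * f j)" if "continuous_on \<Xi> f" for f :: "'a \<Rightarrow> real"
    unfolding P_def integral_distr[OF meas borel_measurable_continuous_on_restrict[OF that]]
    using J w by (simp add: lebesgue_integral_point_measure_finite)
  ultimately show ?thesis using that by blast
qed

section \<open>Convex building blocks of the Lagrangian\<close>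

lemma convex_on_linear:
  fixes f :: "'a::real_vector \<Rightarrow> real"
  assumes "linear f" "convex C"
  shows "convex_on C f"
  using assms by (simp add: convex_on_def linear_add linear_scale)

lemma convex_on_norm_linear:
  fixes f :: "'a::real_vector \<Rightarrow> 'b::real_normed_vector"
  assumes "linear f" "convex C"
  shows "convex_on C (\<lambda>x. norm (f x))"
  using assms
  by (auto simp: convex_on_def linear_add linear_scale intro!: norm_triangle_le)

lemma convex_on_excess:
  fixes f :: "'a::real_vector \<Rightarrow> real"
  assumes "linear f" "convex C"
  shows "convex_on C (\<lambda>x. max (b - f x) 0)"
  unfolding convex_on_def
proof (intro conjI ballI allI impI)
  fix x y :: 'a and u v :: real
  assume uv: "0 \<le> u" "0 \<le> v" "u + v = 1"
  have "b - f (u *\<^sub>R x + v *\<^sub>R y) = (u + v) * b - (u * f x + v * f y)"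
    using assms(1) by (simp add: uv linear_add linear_scale)
  also have "\<dots> = u * (b - f x) + v * (b - f y)" by (simp add: algebra_simps)
  also have "\<dots> \<le> u * max (b - f x) 0 + v * max (b - f y) 0"
    using uv by (intro add_mono mult_left_mono) auto
  finally show "max (b - f (u *\<^sub>R x + v *\<^sub>R y)) 0 \<le> u * max (b - f x) 0 + v * max (b - f y) 0"
    using uv by simp
qed (use assms in auto)

text \<open>The decision \<open>x\<close> is frozen: \<open>g\<close> stands for the
  \<open>\<psi>\<close> loss plus the ridge term, \<open>b\<close> for the loss entering the CVaR,
  and \<open>c\<close> for \<open>1 / (1 - \<beta>)\<close>.\<close>

locale moment_duality =
  fixes \<Xi> :: "(real ^ 'n) set" and \<mu> :: "real ^ 'n" and \<Sigma> :: "real ^ 'n ^ 'n"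
    and \<kappa>\<^sub>1 \<kappa>\<^sub>2 \<tau> c :: real and g b :: "real ^ 'n \<Rightarrow> real"
  assumes compact: "compact \<Xi>" and mean_in: "\<mu> \<in> \<Xi>" and pd: "pd_matrix \<Sigma>"
    and \<kappa>\<^sub>1: "0 < \<kappa>\<^sub>1" and \<kappa>\<^sub>2: "0 < \<kappa>\<^sub>2" and \<tau>: "0 \<le> \<tau>" and c: "1 < c"
    and cont_g: "continuous_on \<Xi> g" and cont_b: "continuous_on \<Xi> b"
begin

abbreviation "\<P> \<equiv> ambiguity_set \<Xi> \<mu> \<Sigma> \<kappa>\<^sub>1 \<kappa>\<^sub>2"

text \<open>The Rockafellar-Uryasev function, whose infimum over \<alpha> is the CVaR of
  \<open>b\<close>.\<close>

definition excess :: "(real ^ 'n) measure \<Rightarrow> real \<Rightarrow> real" where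
  "excess P \<alpha> = \<alpha> + c * (\<integral>\<xi>. max (b \<xi> - \<alpha>) 0 \<partial>P)"

definition primal :: "(real ^ 'n) measure \<Rightarrow> real" where
  "primal P = (\<integral>\<xi>. g \<xi> \<partial>P) + \<tau> * (INF \<alpha>. excess P \<alpha>)"

text \<open>The variable \<open>r\<close> stands for \<open>q + 2 \<Lambda> \<mu>\<close>; it makes the integrand centred at \<open>\<mu>\<close>, so that
  its value at \<open>\<xi> = \<mu>\<close> is coercive.\<close>

definition lagrangian :: "real ^ 'n \<Rightarrow> real \<times> (real ^ 'n) \<times> (real ^ 'n ^ 'n) \<Rightarrow> real" where
  "lagrangian \<xi> \<nu> = g \<xi> + (\<kappa>\<^sub>2 *\<^sub>R \<Sigma> - outer_square (\<xi> - \<mu>)) \<bullet> snd (snd \<nu>)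
     + sqrt \<kappa>\<^sub>1 * norm (matrix_sqrt \<Sigma> *v fst (snd \<nu>)) - fst (snd \<nu>) \<bullet> (\<xi> - \<mu>)
     + \<tau> * (fst \<nu> + c * max (b \<xi> - fst \<nu>) 0)"

text \<open>For \<open>\<tau> = 0\<close> the Lagrangian does not depend on \<alpha>; pinning
  \<alpha> to \<open>0\<close> then keeps sublevel sets bounded.\<close>

definition dual_cone :: "(real \<times> (real ^ 'n) \<times> (real ^ 'n ^ 'n)) set" where
  "dual_cone = {\<alpha>. \<tau> = 0 \<longrightarrow> \<alpha> = 0} \<times> UNIV \<times> {\<Lambda>. psd_matrix \<Lambda>}"

section \<open>Integrating the Lagrangian, and weak duality\<close>

lemma psd: "psd_matrix \<Sigma>"
  using pd by (rule pd_matrix_imp_psd)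

lemma continuous_outer_square: "continuous_on S (\<lambda>\<xi>. outer_square (\<xi> - \<mu>))"
  unfolding outer_square_def by (intro continuous_intros)

lemma continuous_lagrangian: "continuous_on \<Xi> (\<lambda>\<xi>. lagrangian \<xi> \<nu>)"
  unfolding lagrangian_def
  by (intro continuous_intros cont_g cont_b continuous_outer_square)

lemma lagrangian_bounded: "bdd_above ((\<lambda>\<xi>. lagrangian \<xi> \<nu>) ` \<Xi>)"
  using compact_continuous_image[OF continuous_lagrangian compact]
  by (intro bounded_imp_bdd_above compact_imp_bounded)

text \<open>The mean of \<open>b\<close> is a lower bound, because \<open>c\<close> exceeds
  \<open>1\<close> and the positive part dominates \<open>b \<xi> - \<alpha>\<close>. This makes the
  infimum in \<open>primal\<close> a genuine one.\<close>

lemma excess_bdd_below: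
  assumes P: "P \<in> borel_prob_measures \<Xi>"
  shows "bdd_below (range (excess P))"
proof (rule bdd_belowI2)
  fix \<alpha>
  interpret prob_space P using P by (rule prob_space_borel_prob_measures)
  let ?m = "\<lambda>\<xi>. max (b \<xi> - \<alpha>) 0"
  have m: "integrable P ?m"
    by (rule integrable_continuous_on_compact[OF P compact]) (intro continuous_intros cont_b)
  have b: "integrable P b" by (rule integrable_continuous_on_compact[OF P compact cont_b])
  have "(\<integral>\<xi>. b \<xi> \<partial>P) - \<alpha> = (\<integral>\<xi>. b \<xi> - \<alpha> \<partial>P)" using b by (simp add: prob_space)
  also have "\<dots> \<le> (\<integral>\<xi>. ?m \<xi> \<partial>P)" using b m by (intro integral_mono) auto
  also have "\<dots> \<le> c * (\<integral>\<xi>. ?m \<xi> \<partial>P)"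
    using mult_right_mono[of 1 c "\<integral>\<xi>. ?m \<xi> \<partial>P"] c by simp
  finally show "(\<integral>\<xi>. b \<xi> \<partial>P) \<le> excess P \<alpha>" by (simp add: excess_def)
qed

lemma integral_lagrangian:
  assumes P: "P \<in> borel_prob_measures \<Xi>"
  shows "(\<integral>\<xi>. lagrangian \<xi> (\<alpha>, r, \<Lambda>) \<partial>P) = (\<integral>\<xi>. g \<xi> \<partial>P)
    + (\<kappa>\<^sub>2 *\<^sub>R \<Sigma> - (\<integral>\<xi>. outer_square (\<xi> - \<mu>) \<partial>P)) \<bullet> \<Lambda>
    + sqrt \<kappa>\<^sub>1 * norm (matrix_sqrt \<Sigma> *v r) - r \<bullet> ((\<integral>\<xi>. \<xi> \<partial>P) - \<mu>) + \<tau> * excess P \<alpha>"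
proof -
  interpret prob_space P using P by (rule prob_space_borel_prob_measures)
  note int = integrable_continuous_on_compact[OF P compact]
  have [simp]: "integrable P g" "integrable P (\<lambda>\<xi>. max (b \<xi> - \<alpha>) 0)"
    "integrable P (\<lambda>\<xi>. outer_square (\<xi> - \<mu>))" "integrable P (\<lambda>\<xi>. \<xi>)"
    by (intro int continuous_intros cont_g cont_b continuous_outer_square)+
  show ?thesis
    by (simp add: lagrangian_def excess_def inner_diff_left inner_diff_right prob_space
        algebra_simps)
qed

text \<open>In the integrated Lagrangian the second moment slack has a nonnegative product with
  \<Lambda>, the mean terms are nonnegative by Cauchy-Schwarz in the metric of \<Sigma>, and a fixed
  \<alpha> overestimates the infimum.\<close>

lemma weak_duality:
  assumes P: "P \<in> \<P>" and \<Lambda>: "psd_matrix \<Lambda>"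
    and s: "\<And>\<xi>. \<xi> \<in> \<Xi> \<Longrightarrow> lagrangian \<xi> (\<alpha>, r, \<Lambda>) \<le> s"
  shows "primal P \<le> s"
proof -
  have bP: "P \<in> borel_prob_measures \<Xi>" using P by (simp add: ambiguity_set_def)
  interpret prob_space P using bP by (rule prob_space_borel_prob_measures)
  define w where "w = (\<integral>\<xi>. \<xi> \<partial>P) - \<mu>"
  define y where "y = matrix_inv \<Sigma> *v w"
  define R where "R = matrix_sqrt \<Sigma>"
  have R: "psd_matrix R" "R *v (R *v v) = \<Sigma> *v v" for v
    using matrix_sqrt[OF psd] by (simp_all add: R_def matrix_vector_mul_assoc)
  \<comment> \<open>This is the squared Mahalanobis length of the mean deviation
    \<open>w\<close>.\<close>
  have "(norm (R *v y))\<^sup>2 = w \<bullet> y"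
    unfolding R_def norm_matrix_sqrt[OF psd]
    by (simp add: y_def pd_matrix_inv[OF pd] inner_commute)
  also have "\<dots> \<le> \<kappa>\<^sub>1" using P by (simp add: ambiguity_set_def w_def y_def)
  finally have y: "norm (R *v y) \<le> sqrt \<kappa>\<^sub>1" by (rule real_le_rsqrt)
  have "r \<bullet> w = r \<bullet> (R *v (R *v y))" by (simp add: R(2) y_def pd_matrix_inv[OF pd])
  also have "\<dots> = (R *v r) \<bullet> (R *v y)" using psd_matrix_self_adjoint[OF R(1)] by simp
  also have "\<dots> \<le> norm (R *v r) * norm (R *v y)" by (rule norm_cauchy_schwarz)
  also have "\<dots> \<le> sqrt \<kappa>\<^sub>1 * norm (R *v r)"
    using mult_right_mono[OF y norm_ge_zero[of "R *v r"]] by (simp add: mult.commute)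
  finally have rw: "r \<bullet> w \<le> sqrt \<kappa>\<^sub>1 * norm (R *v r)" .
  have "0 \<le> (\<kappa>\<^sub>2 *\<^sub>R \<Sigma> - (\<integral>\<xi>. outer_square (\<xi> - \<mu>) \<partial>P)) \<bullet> \<Lambda>"
    using P \<Lambda> by (intro psd_matrix_inner_nonneg) (simp_all add: ambiguity_set_def loewner_le_def)
  moreover have "\<tau> * (INF \<alpha>. excess P \<alpha>) \<le> \<tau> * excess P \<alpha>"
    using \<tau> excess_bdd_below[OF bP] by (intro mult_left_mono cINF_lower) auto
  ultimately have "primal P \<le> (\<integral>\<xi>. lagrangian \<xi> (\<alpha>, r, \<Lambda>) \<partial>P)"
    using rw unfolding integral_lagrangian[OF bP] primal_def w_def R_def by linarith
  also have "\<dots> \<le> s"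
    using s space_borel_prob_measures[OF bP]
    by (intro integral_le_const integrable_continuous_on_compact[OF bP compact]
        continuous_lagrangian AE_I2) auto
  finally show ?thesis .
qed

text \<open>Scaling \<open>\<Lambda> = s v v\<^sup>T\<close> gives the second moment bound, \<open>r = \<Sigma>\<^sup>-\<^sup>1 (E \<xi> - \<mu>)\<close> the mean bound.\<close>

lemma ambiguity_setI:
  assumes P: "P \<in> borel_prob_measures \<Xi>"
    and K: "\<And>r \<Lambda>. psd_matrix \<Lambda> \<Longrightarrow> K \<le> (\<integral>\<xi>. lagrangian \<xi> (\<alpha>, r, \<Lambda>) \<partial>P)"
  shows "P \<in> \<P>"
proof -
  define M where "M = (\<integral>\<xi>. outer_square (\<xi> - \<mu>) \<partial>P)"
  define w where "w = (\<integral>\<xi>. \<xi> \<partial>P) - \<mu>"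
  define d where "d = (\<integral>\<xi>. g \<xi> \<partial>P) + \<tau> * excess P \<alpha>"
  note int = integral_lagrangian[OF P, folded M_def w_def]
  have "M $ i $ j = M $ j $ i" for i j
  proof -
    have I: "integrable P (\<lambda>\<xi>. outer_square (\<xi> - \<mu>))"
      by (rule integrable_continuous_on_compact[OF P compact continuous_outer_square])
    \<comment> \<open>An entry is the inner product with a matrix unit, so it commutes with the
      integral.\<close>
    have "M $ i $ j = (\<integral>\<xi>. (\<xi> $ i - \<mu> $ i) * (\<xi> $ j - \<mu> $ j) \<partial>P)" for i j
    proof -
      have "M $ i $ j = M \<bullet> axis i (axis j 1)" by (simp add: inner_axis)
      also have "\<dots> = (\<integral>\<xi>. outer_square (\<xi> - \<mu>) \<bullet> axis i (axis j 1) \<partial>P)"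
        unfolding M_def using I by simp
      finally show ?thesis by (simp add: inner_axis outer_square_def)
    qed
    from this[of i j] this[of j i] show ?thesis by (simp add: mult.commute)
  qed
  then have "transpose M = M" by (simp add: transpose_def vec_eq_iff)
  then have "transpose (\<kappa>\<^sub>2 *\<^sub>R \<Sigma> - M) = \<kappa>\<^sub>2 *\<^sub>R \<Sigma> - M"
    using psd by (simp add: transpose_diff transpose_scalar psd_matrix_def)
  moreover have "0 \<le> v \<bullet> ((\<kappa>\<^sub>2 *\<^sub>R \<Sigma> - M) *v v)" for v
  proof (rule nonneg_if_affine_bounded_below)
    fix s :: real assume "s \<ge> 0"
    then have "psd_matrix (s *\<^sub>R outer_square v)"
      by (intro psd_matrix_scaleR psd_matrix_outer_square)
    from K[OF this, of 0] show "K \<le> v \<bullet> ((\<kappa>\<^sub>2 *\<^sub>R \<Sigma> - M) *v v) * s + d"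
      by (simp add: int d_def inner_outer_square mult.commute)
  qed
  ultimately have "M \<preceq> \<kappa>\<^sub>2 *\<^sub>R \<Sigma>" by (simp add: loewner_le_def psd_matrix_def)
  moreover have "w \<bullet> (matrix_inv \<Sigma> *v w) \<le> \<kappa>\<^sub>1"
  proof -
    define y where "y = matrix_inv \<Sigma> *v w"
    define n where "n = norm (matrix_sqrt \<Sigma> *v y)"
    have n2: "n\<^sup>2 = w \<bullet> y"
      unfolding n_def norm_matrix_sqrt[OF psd]
      by (simp add: y_def pd_matrix_inv[OF pd] inner_commute)
    \<comment> \<open>Along the ray \<open>s *\<^sub>R y\<close> the norm term grows with slope
      \<open>sqrt \<kappa>\<^sub>1 * n\<close> and the linear term falls with slope
      \<open>n\<^sup>2\<close>.\<close>
    have "0 \<le> sqrt \<kappa>\<^sub>1 * n - n\<^sup>2"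
    proof (rule nonneg_if_affine_bounded_below)
      fix s :: real assume "s \<ge> 0"
      then show "K \<le> (sqrt \<kappa>\<^sub>1 * n - n\<^sup>2) * s + d"
        using K[OF psd_matrix_zero, of "s *\<^sub>R y"] unfolding n2
        by (simp add: int d_def n_def matrix_vector_mult_scaleR inner_commute[of w] algebra_simps)
    qed
    then have "n \<le> sqrt \<kappa>\<^sub>1"
      using \<kappa>\<^sub>1 by (cases "n = 0") (auto simp: n_def power2_eq_square)
    then have "n\<^sup>2 \<le> (sqrt \<kappa>\<^sub>1)\<^sup>2" by (intro power_mono) (simp_all add: n_def)
    then show ?thesis using \<kappa>\<^sub>1 by (simp add: n2 y_def)
  qed
  ultimately show ?thesis using P by (simp add: ambiguity_set_def M_def w_def)
qed

text \<open>The Dirac measure at \<mu> is admissible: its mean deviation and its second moment about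
  \<mu> vanish, which bounds its Lagrangian below.\<close>

lemma ambiguity_set_nonempty: "\<P> \<noteq> {}"
proof -
  obtain P where P: "P \<in> borel_prob_measures \<Xi>"
    and int: "\<And>f :: _ \<Rightarrow> real. continuous_on \<Xi> f \<Longrightarrow> (\<integral>x. f x \<partial>P) = f \<mu>"
    using finitely_supported_borel_prob_measure[of "{\<mu>}" \<Xi> "\<lambda>_. 1"] mean_in by auto
  have "P \<in> \<P>"
  proof (rule ambiguity_setI[OF P])
    fix r and \<Lambda> :: "real ^ 'n ^ 'n" assume \<Lambda>: "psd_matrix \<Lambda>"
    have "0 \<le> \<Sigma> \<bullet> \<Lambda>" using psd_matrix_inner_nonneg[OF psd \<Lambda>] .
    then show "g \<mu> + \<tau> * (c * max (b \<mu>) 0) \<le> (\<integral>\<xi>. lagrangian \<xi> (0, r, \<Lambda>) \<partial>P)"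
      using \<kappa>\<^sub>1 \<kappa>\<^sub>2 unfolding int[OF continuous_lagrangian]
      by (simp add: lagrangian_def inner_diff_left outer_square_def flip: zero_vec_def)
  qed
  then show ?thesis by blast
qed

text \<open>Weak duality at the zero dual point.\<close>

lemma primal_bdd_above: "bdd_above (primal ` \<P>)"
proof -
  obtain s where "\<And>\<xi>. \<xi> \<in> \<Xi> \<Longrightarrow> lagrangian \<xi> (0, 0, 0) \<le> s"
    using lagrangian_bounded[of "(0, 0, 0)"] by (auto simp: bdd_above_def)
  then show ?thesis
    using weak_duality[OF _ psd_matrix_zero] by (intro bdd_aboveI2[of _ _ s]) blast
qed

section \<open>Convexity and coercivity of the dual problem, and strong duality\<close>

lemma convex_dual_cone: "convex dual_cone"
  unfolding dual_cone_def
  by (intro convex_Times convex_psd_matrix) (cases "\<tau> = 0"; simp)+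

lemma closed_dual_cone: "closed dual_cone"
  unfolding dual_cone_def
  by (intro closed_Times closed_psd_matrix) (cases "\<tau> = 0"; simp)+

lemma linear_matrix_mult_fst_snd: "linear (\<lambda>\<nu> :: real \<times> (real ^ 'n) \<times> 'b::real_vector. A *v fst (snd \<nu>))"
  for A :: "real ^ 'n ^ 'm"
  by (intro linearI) (simp_all add: matrix_vector_right_distrib matrix_vector_mult_scaleR)

lemma convex_lagrangian: "convex_on dual_cone (lagrangian \<xi>)"
proof -
  note C = convex_dual_cone
  have lin: "convex_on dual_cone (\<lambda>\<nu>. (\<kappa>\<^sub>2 *\<^sub>R \<Sigma> - outer_square (\<xi> - \<mu>)) \<bullet> snd (snd \<nu>)
      - fst (snd \<nu>) \<bullet> (\<xi> - \<mu>) + \<tau> * fst \<nu>)"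
    by (intro convex_on_linear C linearI)
      (simp_all add: inner_add_right inner_add_left algebra_simps)
  have norm: "convex_on dual_cone (\<lambda>\<nu>. sqrt \<kappa>\<^sub>1 * norm (matrix_sqrt \<Sigma> *v fst (snd \<nu>)))"
    using \<kappa>\<^sub>1 by (intro convex_on_cmul convex_on_norm_linear C linear_matrix_mult_fst_snd) auto
  have max: "convex_on dual_cone (\<lambda>\<nu>. \<tau> * c * max (b \<xi> - fst \<nu>) 0)"
    using \<tau> c by (intro convex_on_cmul convex_on_excess C linear_fst) auto
  have const: "convex_on dual_cone (\<lambda>_. g \<xi>)" using C by (simp add: convex_on_const)
  show ?thesis
    using convex_on_add[OF const convex_on_add[OF lin convex_on_add[OF norm max]]]
    by (simp add: lagrangian_def[abs_def] algebra_simps)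
qed

lemma continuous_lagrangian_dual: "continuous_on S (lagrangian \<xi>)"
  unfolding lagrangian_def[abs_def]
  by (intro continuous_intros bounded_linear.continuous_on[OF matrix_vector_mul_bounded_linear])

text \<open>At \<open>\<xi> = \<mu>\<close> the subtracted terms vanish. The rest grows in \<Lambda>
  by definiteness of \<Sigma>, in \<open>r\<close> by injectivity of its root, and, for positive
  \<tau>, in \<alpha> because the slopes \<open>1\<close> and \<open>1 - c\<close> have opposite
  signs.\<close>

lemma compact_sublevel: "compact {\<nu> \<in> dual_cone. lagrangian \<mu> \<nu> \<le> t}"
proof -
  obtain a where a: "a > 0" "\<And>\<Lambda>. psd_matrix \<Lambda> \<Longrightarrow> a * norm \<Lambda> \<le> \<Sigma> \<bullet> \<Lambda>"
    using pd_matrix_coercive[OF pd] by blast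
  obtain e where e: "e > 0" "\<And>r. e * norm r \<le> norm (matrix_sqrt \<Sigma> *v r)"
    using pd_matrix_sqrt_bounded_below[OF pd] by blast
  define s where "s = t - g \<mu>"
  \<comment> \<open>The budget left for \<Lambda> and \<open>r\<close> after the \<alpha> term takes
    its minimum \<open>\<tau> * b \<mu>\<close>.\<close>
  define s' where "s' = s - \<tau> * b \<mu>"
  \<comment> \<open>The summands come from \<open>\<alpha> \<le> T\<close> and
    \<open>c * b \<mu> - (c - 1) * \<alpha> \<le> T\<close>. For \<open>\<tau> = 0\<close> division
    yields \<open>0\<close>, and the pinned \<open>\<alpha> = 0\<close> is in the ball
    anyway.\<close>
  define B1 where "B1 = \<bar>s / \<tau>\<bar> + \<bar>(c * b \<mu> - s / \<tau>) / (c - 1)\<bar>"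
  have "{\<nu> \<in> dual_cone. lagrangian \<mu> \<nu> \<le> t}
    \<subseteq> cball 0 B1 \<times> cball 0 (s' / (sqrt \<kappa>\<^sub>1 * e)) \<times> cball 0 (s' / (\<kappa>\<^sub>2 * a))"
  proof clarify
    fix \<alpha> r \<Lambda> assume cone: "(\<alpha>, r, \<Lambda>) \<in> dual_cone" and le: "lagrangian \<mu> (\<alpha>, r, \<Lambda>) \<le> t"
    have psd\<Lambda>: "psd_matrix \<Lambda>" and \<alpha>0: "\<tau> = 0 \<longrightarrow> \<alpha> = 0"
      using cone unfolding dual_cone_def by blast+
    define T where "T = \<alpha> + c * max (b \<mu> - \<alpha>) 0"
    have sum: "\<kappa>\<^sub>2 * (\<Sigma> \<bullet> \<Lambda>) + sqrt \<kappa>\<^sub>1 * norm (matrix_sqrt \<Sigma> *v r) + \<tau> * T \<le> s"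
      using le by (simp add: lagrangian_def s_def T_def inner_diff_left outer_square_def
          flip: zero_vec_def)
    have "max (b \<mu> - \<alpha>) 0 \<le> c * max (b \<mu> - \<alpha>) 0"
      using mult_right_mono[of 1 c "max (b \<mu> - \<alpha>) 0"] c by simp
    then have "b \<mu> \<le> T" unfolding T_def by linarith
    then have T: "\<tau> * b \<mu> \<le> \<tau> * T" using \<tau> by (rule mult_left_mono)
    have 1: "\<kappa>\<^sub>2 * (a * norm \<Lambda>) \<le> \<kappa>\<^sub>2 * (\<Sigma> \<bullet> \<Lambda>)"
      using a(2)[OF psd\<Lambda>] \<kappa>\<^sub>2 by (intro mult_left_mono) auto
    have 2: "sqrt \<kappa>\<^sub>1 * (e * norm r) \<le> sqrt \<kappa>\<^sub>1 * norm (matrix_sqrt \<Sigma> *v r)"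
      using e(2)[of r] \<kappa>\<^sub>1 by (intro mult_left_mono) auto
    have 3: "0 \<le> \<kappa>\<^sub>2 * (a * norm \<Lambda>)" "0 \<le> sqrt \<kappa>\<^sub>1 * (e * norm r)"
      using a(1) e(1) \<kappa>\<^sub>1 \<kappa>\<^sub>2 by auto
    have "\<kappa>\<^sub>2 * (a * norm \<Lambda>) \<le> s'" "sqrt \<kappa>\<^sub>1 * (e * norm r) \<le> s'"
      using sum T 1 2 3 unfolding s'_def by linarith+
    then have "norm \<Lambda> \<le> s' / (\<kappa>\<^sub>2 * a)" "norm r \<le> s' / (sqrt \<kappa>\<^sub>1 * e)"
      using a(1) e(1) \<kappa>\<^sub>1 \<kappa>\<^sub>2 by (simp_all add: field_simps)
    moreover have "\<bar>\<alpha>\<bar> \<le> B1"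
    proof (cases "\<tau> = 0")
      case True
      then show ?thesis using \<alpha>0 by (simp add: B1_def)
    next
      case False
      have "\<tau> * T \<le> s" using sum 1 2 3 by linarith
      then have T: "T \<le> s / \<tau>" using False \<tau> by (simp add: field_simps)
      have "0 \<le> c * max (b \<mu> - \<alpha>) 0" using c by simp
      then have up: "\<alpha> \<le> s / \<tau>" using T unfolding T_def by linarith
      have "c * (b \<mu> - \<alpha>) \<le> c * max (b \<mu> - \<alpha>) 0" using c by (intro mult_left_mono) auto
      then have "c * b \<mu> - s / \<tau> \<le> \<alpha> * (c - 1)" using T unfolding T_def
        by (simp add: algebra_simps)
      then have "(c * b \<mu> - s / \<tau>) / (c - 1) \<le> \<alpha>" using c by (simp add: divide_le_eq)
      with up show ?thesis unfolding B1_def by linarith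
    qed
    ultimately show "\<alpha> \<in> cball 0 B1 \<and> (r, \<Lambda>) \<in> cball 0 (s' / (sqrt \<kappa>\<^sub>1 * e)) \<times> cball 0 (s' / (\<kappa>\<^sub>2 * a))"
      by simp
  qed
  then have "bounded {\<nu> \<in> dual_cone. lagrangian \<mu> \<nu> \<le> t}"
    by (rule bounded_subset[rotated]) (intro bounded_Times bounded_cball)
  moreover have "closed {\<nu> \<in> dual_cone. lagrangian \<mu> \<nu> \<le> t}"
    by (intro continuous_on_closed_Collect_le closed_dual_cone continuous_lagrangian_dual
        continuous_on_const)
  ultimately show ?thesis by (simp add: compact_eq_bounded_closed)
qed

text \<open>Failure would yield a finitely supported \<open>P\<close> whose integrated Lagrangian is
  at least some \<open>t > v\<close> on the whole cone. This bound makes \<open>P\<close> admissible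
  and, at \<open>r = 0\<close> and \<open>\<Lambda> = 0\<close>, lifts its primal value above the
  supremum \<open>v\<close>.\<close>

lemma strong_duality:
  "\<exists>\<alpha> r \<Lambda>. psd_matrix \<Lambda> \<and>
     (\<forall>\<xi>\<in>\<Xi>. lagrangian \<xi> (\<alpha>, r, \<Lambda>) \<le> (SUP P\<in>\<P>. primal P))"
proof (rule ccontr)
  define v where "v = (SUP P\<in>\<P>. primal P)"
  assume contr: "\<not> ?thesis"
  have none: "\<exists>\<xi>\<in>\<Xi>. v < lagrangian \<xi> \<nu>" if "\<nu> \<in> dual_cone" for \<nu>
    using that contr unfolding v_def[symmetric] dual_cone_def by (cases \<nu>) (force simp: not_le)
  \<comment> \<open>Every sublevel set at \<mu> is compact, so any level above \<open>v\<close>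
    serves; \<open>v + 1\<close> is one.\<close>
  obtain t J w where "v < t" and J: "finite J" "J \<subseteq> \<Xi>"
    and w: "\<And>\<xi>. \<xi> \<in> J \<Longrightarrow> 0 \<le> w \<xi>" "sum w J = 1"
    and ge: "\<And>\<nu>. \<nu> \<in> dual_cone \<Longrightarrow> t \<le> (\<Sum>\<xi>\<in>J. w \<xi> * lagrangian \<xi> \<nu>)"
    by (rule convex_minimax_finite[of dual_cone \<Xi> lagrangian \<mu> v "v + 1",
        OF convex_dual_cone closed_dual_cone convex_lagrangian continuous_lagrangian_dual
        mean_in _ compact_sublevel none]) auto
  obtain P where P: "P \<in> borel_prob_measures \<Xi>"
    and int: "\<And>f :: _ \<Rightarrow> real. continuous_on \<Xi> f \<Longrightarrow> (\<integral>\<xi>. f \<xi> \<partial>P) = (\<Sum>\<xi>\<in>J. w \<xi> * f \<xi>)"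
    using finitely_supported_borel_prob_measure[OF J w] by blast
  have ge: "t \<le> (\<integral>\<xi>. lagrangian \<xi> \<nu> \<partial>P)" if "\<nu> \<in> dual_cone" for \<nu>
    using ge[OF that] by (simp add: int continuous_lagrangian)
  \<comment> \<open>\<open>\<alpha> = 0\<close> lies in the cone whether or not \<tau>
    vanishes.\<close>
  have amb: "P \<in> \<P>"
    by (rule ambiguity_setI[OF P, of t 0], rule ge) (simp add: dual_cone_def)
  have excess_ge: "t \<le> (\<integral>\<xi>. g \<xi> \<partial>P) + \<tau> * excess P \<alpha>" if "\<tau> = 0 \<longrightarrow> \<alpha> = 0" for \<alpha>
    using ge[of "(\<alpha>, 0, 0)"] that by (simp add: dual_cone_def psd_matrix_zero integral_lagrangian[OF P])
  have "t \<le> primal P"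
  proof (cases "\<tau> = 0")
    case True
    then show ?thesis using excess_ge[of 0] unfolding primal_def by simp
  next
    case False
    have "(t - (\<integral>\<xi>. g \<xi> \<partial>P)) / \<tau> \<le> (INF \<alpha>. excess P \<alpha>)"
      using excess_ge False \<tau> by (intro cINF_greatest) (auto simp: field_simps)
    then show ?thesis using False \<tau> by (simp add: primal_def field_simps)
  qed
  also have "\<dots> \<le> v" unfolding v_def using primal_bdd_above amb by (intro cSUP_upper)
  finally show False using \<open>v < t\<close> by simp
qed

end

section \<open>Reformulation of the CVaR problem\<close>

text \<open>On the reals \<open>Inf\<close> depends only on the set of lower bounds, even where it is a junk value.\<close>

lemma Inf_real_eqI:
  fixes A B :: "real set"
  assumes "\<And>l. (\<forall>x\<in>A. l \<le> x) \<longleftrightarrow> (\<forall>x\<in>B. l \<le> x)"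
  shows "Inf A = Inf B"
proof -
  have "(\<forall>x\<in>uminus ` A. x \<le> z) \<longleftrightarrow> (\<forall>x\<in>uminus ` B. x \<le> z)" for z
    using assms[of "- z"] by (auto simp: minus_le_iff)
  then show ?thesis by (simp add: Inf_real_def Sup_real_def)
qed

lemma continuous_on_part_a: "continuous_on S part_a"
  unfolding part_a_def[abs_def] by (intro continuous_intros)

lemma continuous_on_part_B: "continuous_on S part_B"
  unfolding part_B_def[abs_def] by (intro continuous_intros)

text \<open>A convex combination with equal weights. It makes \<mu> a point of \<Xi>, where
  coercivity and the Dirac measure are taken.\<close>

lemma sample_mean_mem:
  assumes "convex S" "0 < N" "\<And>k. k < N \<Longrightarrow> obs k \<in> S"
  shows "sample_mean N obs \<in> S"
  unfolding sample_mean_def scaleR_sum_right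
  using assms by (intro convex_sum) auto

text \<open>Expanding the form of \<Lambda> at \<open>\<xi> - \<mu>\<close>, the remaining linear
  terms combine with \<open>q\<close> into \<open>q + 2 *\<^sub>R (\<Lambda> *v \<mu>)\<close>, the
  vector already inside the norm of \<open>h\<close>.\<close>

lemma h_eq_centred:
  assumes \<Lambda>: "psd_matrix \<Lambda>"
  shows "h \<mu> \<Sigma> \<kappa>\<^sub>1 \<kappa>\<^sub>2 \<psi> \<tau>\<^sub>1 \<tau>\<^sub>2 \<beta> \<xi> (x, \<alpha>, q, \<Lambda>)
    = \<psi> (part_a \<xi> - part_B \<xi> \<bullet> x) + \<tau>\<^sub>1 * (norm x)\<^sup>2
      + (\<kappa>\<^sub>2 *\<^sub>R \<Sigma> - outer_square (\<xi> - \<mu>)) \<bullet> \<Lambda>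
      + sqrt \<kappa>\<^sub>1 * norm (matrix_sqrt \<Sigma> *v (q + 2 *\<^sub>R (\<Lambda> *v \<mu>)))
      - (q + 2 *\<^sub>R (\<Lambda> *v \<mu>)) \<bullet> (\<xi> - \<mu>)
      + \<tau>\<^sub>2 * (\<alpha> + 1 / (1 - \<beta>) * max (- (x \<bullet> part_B \<xi>) - \<alpha>) 0)"
proof -
  have t: "transpose \<Lambda> = \<Lambda>" using \<Lambda> by (simp add: psd_matrix_def)
  have "outer_square (\<xi> - \<mu>) \<bullet> \<Lambda> = (\<xi> - \<mu>) \<bullet> (\<Lambda> *v (\<xi> - \<mu>))"
    using inner_outer_square[of \<Lambda> "\<xi> - \<mu>"] by (simp add: inner_commute)
  also have "\<dots> = (\<Lambda> *v \<xi>) \<bullet> \<xi> - 2 * ((\<Lambda> *v \<mu>) \<bullet> \<xi>) + (\<Lambda> *v \<mu>) \<bullet> \<mu>"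
    using psd_matrix_self_adjoint[OF \<Lambda>, of \<mu> \<xi>]
    by (simp add: matrix_vector_mult_diff_distrib inner_diff_left inner_diff_right inner_commute)
  finally show ?thesis
    by (simp add: h_def h1_def h2_def t inner_add_left inner_diff_left inner_diff_right
        algebra_simps del: transpose_matrix_vector)
qed

text \<open>\<open>f x\<close> is the attained minimum of \<open>F\<close> over the second variable,
  so both problems have the same lower bounds. Attainment is what extends a minimiser of
  \<open>f\<close> to one of \<open>F\<close>.\<close>

lemma attained_partial_min:
  fixes f :: "'a \<Rightarrow> real" and F :: "'a \<times> 'b \<Rightarrow> real"
  assumes le: "\<And>x y. x \<in> X \<Longrightarrow> y \<in> Y \<Longrightarrow> f x \<le> F (x, y)"
    and ex: "\<And>x. x \<in> X \<Longrightarrow> \<exists>y\<in>Y. F (x, y) \<le> f x"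
  shows "Inf (f ` X) = Inf (F ` (X \<times> Y))"
    and "is_arg_min f (\<lambda>x. x \<in> X) x \<longleftrightarrow> (\<exists>y. is_arg_min F (\<lambda>z. z \<in> X \<times> Y) (x, y))"
proof -
  have lb: "(\<forall>x\<in>X. l \<le> f x) \<longleftrightarrow> (\<forall>z\<in>X \<times> Y. l \<le> F z)" for l
    using le ex by (auto, meson order_trans, meson order_trans)
  then show "Inf (f ` X) = Inf (F ` (X \<times> Y))" by (intro Inf_real_eqI) auto
  show "is_arg_min f (\<lambda>x. x \<in> X) x \<longleftrightarrow> (\<exists>y. is_arg_min F (\<lambda>z. z \<in> X \<times> Y) (x, y))"
  proof
    assume "is_arg_min f (\<lambda>x. x \<in> X) x"
    then have x: "x \<in> X" and min: "\<forall>z\<in>X. f x \<le> f z" by (auto simp: is_arg_min_linorder)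
    obtain y where y: "y \<in> Y" "F (x, y) \<le> f x" using ex[OF x] by blast
    have "\<forall>z\<in>X \<times> Y. f x \<le> F z" using lb min by blast
    then show "\<exists>y. is_arg_min F (\<lambda>z. z \<in> X \<times> Y) (x, y)"
      using x y unfolding is_arg_min_linorder by (intro exI[of _ y]) fastforce
  next
    assume "\<exists>y. is_arg_min F (\<lambda>z. z \<in> X \<times> Y) (x, y)"
    then obtain y where xy: "x \<in> X" "y \<in> Y" and min: "\<forall>z\<in>X \<times> Y. F (x, y) \<le> F z"
      by (auto simp: is_arg_min_linorder)
    have "\<forall>z\<in>X. F (x, y) \<le> f z" using lb min by blast
    moreover have "f x \<le> F (x, y)" using le xy by blast
    ultimately show "is_arg_min f (\<lambda>x. x \<in> X) x"
      using xy(1) unfolding is_arg_min_linorder by fastforce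
  qed
qed

theorem theorem3p3:
  fixes \<Xi> :: "(real ^ ('d::finite + 1)) set"
    and obs :: "nat \<Rightarrow> real ^ ('d + 1)" and N :: nat
    and \<mu> :: "real ^ ('d + 1)" and \<Sigma> :: "real ^ ('d + 1) ^ ('d + 1)"
    and \<psi> :: "real \<Rightarrow> real" and \<kappa>\<^sub>1 \<kappa>\<^sub>2 \<tau>\<^sub>1 \<tau>\<^sub>2 \<beta> :: real
  assumes "convex \<Xi>" and "compact \<Xi>"
    and "0 < N" and "\<And>k. k < N \<Longrightarrow> obs k \<in> \<Xi>"
    and "\<mu> = sample_mean N obs" and "\<Sigma> = sample_cov N obs" and "pd_matrix \<Sigma>"
    and "convex_on UNIV \<psi>"
    and "0 \<le> \<tau>\<^sub>1" and "0 \<le> \<tau>\<^sub>2" and "0 < \<beta>" and "\<beta> < 1" and "0 < \<kappa>\<^sub>1" and "0 < \<kappa>\<^sub>2"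
  shows "(INF x\<in>prob_simplex. drcvar_obj \<Xi> \<mu> \<Sigma> \<kappa>\<^sub>1 \<kappa>\<^sub>2 \<psi> \<tau>\<^sub>1 \<tau>\<^sub>2 \<beta> x)
           = (INF \<nu>\<in>nsdp_feasible. nsdp_obj \<Xi> \<mu> \<Sigma> \<kappa>\<^sub>1 \<kappa>\<^sub>2 \<psi> \<tau>\<^sub>1 \<tau>\<^sub>2 \<beta> \<nu>) \<and>
         (\<forall>x. is_arg_min (drcvar_obj \<Xi> \<mu> \<Sigma> \<kappa>\<^sub>1 \<kappa>\<^sub>2 \<psi> \<tau>\<^sub>1 \<tau>\<^sub>2 \<beta>) (\<lambda>x. x \<in> prob_simplex) x \<longleftrightarrow>
           (\<exists>\<alpha> q \<Lambda>. is_arg_min (nsdp_obj \<Xi> \<mu> \<Sigma> \<kappa>\<^sub>1 \<kappa>\<^sub>2 \<psi> \<tau>\<^sub>1 \<tau>\<^sub>2 \<beta>) (\<lambda>\<nu>. \<nu> \<in> nsdp_feasible) (x, \<alpha>, q, \<Lambda>)))"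
proof -
  define F where "F = nsdp_obj \<Xi> \<mu> \<Sigma> \<kappa>\<^sub>1 \<kappa>\<^sub>2 \<psi> \<tau>\<^sub>1 \<tau>\<^sub>2 \<beta>"
  define f where "f = drcvar_obj \<Xi> \<mu> \<Sigma> \<kappa>\<^sub>1 \<kappa>\<^sub>2 \<psi> \<tau>\<^sub>1 \<tau>\<^sub>2 \<beta>"
  define Y where "Y = (UNIV :: real set) \<times> (UNIV :: (real ^ ('d + 1)) set)
    \<times> {\<Lambda> :: real ^ ('d + 1) ^ ('d + 1). psd_matrix \<Lambda>}"
  have \<mu>: "\<mu> \<in> \<Xi>" using assms(1,3,4,5) sample_mean_mem by blast
  \<comment> \<open>A finite convex function on the line is continuous, which gives measurability
    and boundedness on \<Xi>.\<close>
  have \<psi>: "continuous_on UNIV \<psi>" using assms(8) by (intro convex_on_continuous) auto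
  have dual: "(\<forall>y\<in>Y. f x \<le> F (x, y)) \<and> (\<exists>y\<in>Y. F (x, y) \<le> f x)" for x
  proof -
    \<comment> \<open>The ridge term is constant in \<xi>, so it passes through every expectation
      unchanged.\<close>
    define g where "g = (\<lambda>\<xi>. \<psi> (part_a \<xi> - part_B \<xi> \<bullet> x) + \<tau>\<^sub>1 * (norm x)\<^sup>2)"
    define b where "b = (\<lambda>\<xi>. - (x \<bullet> part_B \<xi>))"
    interpret moment_duality \<Xi> \<mu> \<Sigma> \<kappa>\<^sub>1 \<kappa>\<^sub>2 \<tau>\<^sub>2 "1 / (1 - \<beta>)" g b
    proof
      show "continuous_on \<Xi> g" unfolding g_def
        by (intro continuous_intros continuous_on_compose2[OF \<psi>] continuous_on_part_a
            continuous_on_part_B) auto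
      show "continuous_on \<Xi> b" unfolding b_def by (intro continuous_intros continuous_on_part_B)
    qed (use assms \<mu> in auto)
    have h: "h \<mu> \<Sigma> \<kappa>\<^sub>1 \<kappa>\<^sub>2 \<psi> \<tau>\<^sub>1 \<tau>\<^sub>2 \<beta> \<xi> (x, \<alpha>, q, \<Lambda>)
        = lagrangian \<xi> (\<alpha>, q + 2 *\<^sub>R (\<Lambda> *v \<mu>), \<Lambda>)" if "psd_matrix \<Lambda>" for \<xi> \<alpha> q \<Lambda>
      unfolding h_eq_centred[OF that] lagrangian_def by (simp add: g_def b_def)
    have F: "F (x, \<alpha>, q, \<Lambda>) = (SUP \<xi>\<in>\<Xi>. lagrangian \<xi> (\<alpha>, q + 2 *\<^sub>R (\<Lambda> *v \<mu>), \<Lambda>))"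
      if "psd_matrix \<Lambda>" for \<alpha> q \<Lambda>
      by (simp add: F_def nsdp_obj_def h[OF that])
    have "primal P = (\<integral>\<xi>. \<psi> (part_a \<xi> - part_B \<xi> \<bullet> x) \<partial>P) + \<tau>\<^sub>1 * (norm x)\<^sup>2
        + \<tau>\<^sub>2 * cvar \<beta> P x" if "P \<in> \<P>" for P
    proof -
      have P: "P \<in> borel_prob_measures \<Xi>" using that by (simp add: ambiguity_set_def)
      interpret prob_space P using P by (rule prob_space_borel_prob_measures)
      have "integrable P (\<lambda>\<xi>. \<psi> (part_a \<xi> - part_B \<xi> \<bullet> x))"
        by (intro integrable_continuous_on_compact[OF P assms(2)] continuous_intros
            continuous_on_compose2[OF \<psi>] continuous_on_part_a continuous_on_part_B) auto
      then show ?thesis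
        unfolding primal_def excess_def cvar_def by (simp add: g_def b_def prob_space)
    qed
    then have f: "f x = (SUP P\<in>\<P>. primal P)"
      by (simp add: f_def drcvar_obj_def)
    have "f x \<le> F (x, \<alpha>, q, \<Lambda>)" if \<Lambda>: "psd_matrix \<Lambda>" for \<alpha> q \<Lambda>
      unfolding f F[OF \<Lambda>]
    proof (intro cSUP_least ambiguity_set_nonempty)
      fix P assume "P \<in> \<P>"
      then show "primal P \<le> (SUP \<xi>\<in>\<Xi>. lagrangian \<xi> (\<alpha>, q + 2 *\<^sub>R (\<Lambda> *v \<mu>), \<Lambda>))"
        by (rule weak_duality[OF _ \<Lambda>, where \<alpha> = \<alpha> and r = "q + 2 *\<^sub>R (\<Lambda> *v \<mu>)"])
          (intro cSUP_upper lagrangian_bounded)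
    qed
    moreover obtain \<alpha> r \<Lambda> where \<Lambda>: "psd_matrix \<Lambda>"
      and le: "\<And>\<xi>. \<xi> \<in> \<Xi> \<Longrightarrow> lagrangian \<xi> (\<alpha>, r, \<Lambda>) \<le> f x"
      using strong_duality unfolding f by blast
    \<comment> \<open>The third argument undoes the substitution
      \<open>r = q + 2 *\<^sub>R (\<Lambda> *v \<mu>)\<close>.\<close>
    then have "F (x, \<alpha>, r - 2 *\<^sub>R (\<Lambda> *v \<mu>), \<Lambda>) \<le> f x"
      using \<mu> unfolding F[OF \<Lambda>] by (intro cSUP_least) auto
    ultimately show ?thesis using \<Lambda> unfolding Y_def by blast
  qed
  have feas: "nsdp_feasible = prob_simplex \<times> Y" by (simp add: nsdp_feasible_def Y_def)
  have le: "\<And>x y. x \<in> prob_simplex \<Longrightarrow> y \<in> Y \<Longrightarrow> f x \<le> F (x, y)"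
    and ex: "\<And>x. x \<in> prob_simplex \<Longrightarrow> \<exists>y\<in>Y. F (x, y) \<le> f x"
    using dual by blast+
  show ?thesis
    using attained_partial_min[of prob_simplex Y f F, OF le ex]
    unfolding feas F_def f_def by (simp add: split_paired_Ex)
qed

end
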